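(* Let $G$ be a finite simple graph with matching number $\beta(G)=\beta\geq 2$ and size (number of edges) $m\geq \beta$. Then $q(G)\leq q(S_{a,b,c})$, with equality if and only if $G$ is isomorphic to $S_{a,b,c}$ together with possibly some isolated edges and isolated vertices, where the nonnegative integers $a,b,c$ are given as follows: (i) if $m\geq 3\beta-1$, then $a=m-3\beta+3$, $b=0$ and $c=\beta-1$; (ii) if $m\leq 3\beta-2$ and $m-\beta$ is odd, then $a=b=1$ and $c=\frac{m-\beta-1}{2}$; (iii) if $m\leq 3\beta-2$ and $m-\beta$ is even, then $a=1$, $b=0$ and $c=\frac{m-\beta}{2}$.
   Context: All graphs are finite, simple and undirected. For a graph $G$, $Q(G)=D(G)+A(G)$ is the signless Laplacian matrix (degree diagonal matrix plus adjacency matrix), and $q(G)$, the $Q$-spectral radius, is the largest eigenvalue of $Q(G)$. The matching number $\beta(G)$ is the maximum number of pairwise disjoint edges of $G$. For integers $a,b,c\geq 0$, $S_{a,b,c}$ denotes the graph obtained from a single vertex $v_1$ by attaching $a$ pendant edges, $b$ pendant paths of length $2$ (paths $v_1 - x - y$ with $x,y$ new), and $c$ pendant triangles (triangles $v_1xy$ with $x,y$ new), all new vertices distinct. *)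

theory Defs
  imports Complex_Main
begin

definition simple_graph :: "'a set \<Rightarrow> 'a set set \<Rightarrow> bool" where
  "simple_graph V E \<longleftrightarrow> finite V \<and>
     (\<forall>e\<in>E. \<exists>u v. u \<in> V \<and> v \<in> V \<and> u \<noteq> v \<and> e = {u, v})"

definition is_matching :: "'a set set \<Rightarrow> 'a set set \<Rightarrow> bool" where
  "is_matching E M \<longleftrightarrow> M \<subseteq> E \<and> (\<forall>e\<in>M. \<forall>f\<in>M. e \<noteq> f \<longrightarrow> e \<inter> f = {})"

definition matching_number :: "'a set set \<Rightarrow> nat" where
  "matching_number E = Max (card ` {M. is_matching E M})"

definition degree :: "'a set set \<Rightarrow> 'a \<Rightarrow> nat" where
  "degree E v = card {e \<in> E. v \<in> e}"

definition signless_laplacian_apply ::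
    "'a set \<Rightarrow> 'a set set \<Rightarrow> ('a \<Rightarrow> real) \<Rightarrow> 'a \<Rightarrow> real" where
  "signless_laplacian_apply V E x u =
     real (degree E u) * x u + (\<Sum>v\<in>{v \<in> V. {u, v} \<in> E}. x v)"

definition Q_eigenvalue :: "'a set \<Rightarrow> 'a set set \<Rightarrow> real \<Rightarrow> bool" where
  "Q_eigenvalue V E mu \<longleftrightarrow>
     (\<exists>x. (\<forall>u. u \<notin> V \<longrightarrow> x u = 0) \<and> (\<exists>u\<in>V. x u \<noteq> 0) \<and>
          (\<forall>u\<in>V. signless_laplacian_apply V E x u = mu * x u))"

definition q_radius :: "'a set \<Rightarrow> 'a set set \<Rightarrow> real" where
  "q_radius V E = Max {mu. Q_eigenvalue V E mu}"

definition graph_iso :: "'a set \<Rightarrow> 'a set set \<Rightarrow> 'b set \<Rightarrow> 'b set set \<Rightarrow> bool" where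
  "graph_iso V1 E1 V2 E2 \<longleftrightarrow>
     (\<exists>f. bij_betw f V1 V2 \<and> (\<forall>u\<in>V1. \<forall>v\<in>V1. {u, v} \<in> E1 \<longleftrightarrow> {f u, f v} \<in> E2))"

datatype svert = Center | Pend nat | PMid nat | PEnd nat | TriA nat | TriB nat
  | IsoE1 nat | IsoE2 nat | IsoV nat

definition S_ext_V :: "nat \<Rightarrow> nat \<Rightarrow> nat \<Rightarrow> nat \<Rightarrow> nat \<Rightarrow> svert set" where
  "S_ext_V a b c k l = {Center} \<union> Pend ` {..<a} \<union> PMid ` {..<b} \<union> PEnd ` {..<b}
     \<union> TriA ` {..<c} \<union> TriB ` {..<c} \<union> IsoE1 ` {..<k} \<union> IsoE2 ` {..<k} \<union> IsoV ` {..<l}"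

definition S_ext_E :: "nat \<Rightarrow> nat \<Rightarrow> nat \<Rightarrow> nat \<Rightarrow> nat \<Rightarrow> svert set set" where
  "S_ext_E a b c k l =
       (\<lambda>i. {Center, Pend i}) ` {..<a}
     \<union> (\<lambda>i. {Center, PMid i}) ` {..<b} \<union> (\<lambda>i. {PMid i, PEnd i}) ` {..<b}
     \<union> (\<lambda>i. {Center, TriA i}) ` {..<c} \<union> (\<lambda>i. {Center, TriB i}) ` {..<c}
     \<union> (\<lambda>i. {TriA i, TriB i}) ` {..<c}
     \<union> (\<lambda>i. {IsoE1 i, IsoE2 i}) ` {..<k}"

abbreviation S_V :: "nat \<Rightarrow> nat \<Rightarrow> nat \<Rightarrow> svert set" where
  "S_V a b c \<equiv> S_ext_V a b c 0 0"

abbreviation S_E :: "nat \<Rightarrow> nat \<Rightarrow> nat \<Rightarrow> svert set set" where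
  "S_E a b c \<equiv> S_ext_E a b c 0 0"

end

theory Submission
  imports Defs "Jordan_Normal_Form.Spectral_Radius"
begin

text \<open>
  Put \<open>t = m - \<beta>\<close> and \<open>r = q(S\<^bsub>a,b,c\<^esub>)\<close>. The centre of \<open>S\<^bsub>a,b,c\<^esub>\<close> has degree \<open>t + 1\<close>, and
  \<open>r > t + 2\<close> unless \<open>t = 0\<close>, when \<open>G\<close> is a matching plus isolated vertices. Deleting the edges at
  two adjacent vertices destroys at most two edges of a maximum matching, so \<open>d(u) + d(v) \<le> t + 3\<close> for each edge \<open>uv\<close>. If no edge attains this,
  the degree vector is a test vector showing \<open>q(G) \<le> t + 2 < r\<close>.

  If \<open>uv\<close> attains it and \<open>d(u) \<ge> d(v)\<close>, then \<open>G - {u, v}\<close> consists of disjoint edges and isolated vertices.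
  For \<open>d(v) \<ge> 4\<close> the degree vector again gives \<open>t + 2\<close>. For \<open>d(v) = 2\<close> the graph is some
  \<open>S\<^bsub>a',b',c'\<^esub>\<close> plus isolated edges and vertices, and exchanging pendant edges for paths and paths for
  triangles increases \<open>q\<close>. For \<open>d(v) = 3\<close> the eigenvector of \<open>S\<^bsub>a,b,c\<^esub>\<close> with eigenvalue \<open>r\<close>, transplanted to
  \<open>G\<close> with \<open>u\<close> as centre and modified near \<open>v\<close>, is a test vector showing \<open>q(G) < r\<close>.
\<close>

section \<open>Eigenvalues of the signless Laplacian\<close>

text \<open>Upper bounds come from positive test vectors, and all comparisons are made at the single
  number r. The entries of the eigenvector away from the centre depend on r alone, so q of each
  S_{a,b,c} solves a scalar equation, r = degree of the centre + \<open>S_sum\<close>. For a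
  competing graph it is enough that the same entries leave a deficit at its centre; its own largest
  eigenvalue is never located. Since a deficit at one reachable vertex already forces q < r, every
  graph is either strictly below r or isomorphic to the extremal one, and this dichotomy contains
  the equality case. The split by d(v) is dictated by the degree vector. At u, with x of degree at
  most 2 and the neighbours other than v and x of degree at most 3, it yields t + 2 exactly when
  (d(v) - 4) * (d(u) - 1) \<ge> 0. For d(v) = 3 this estimate breaks down, and a vector tuned to the
  few vertices near v takes over. There the margin is small when t = 3, which is why a numerical
  lower bound on r is needed.\<close>

lemma spectrum_indexed:
  fixes M :: "'a \<Rightarrow> 'a \<Rightarrow> 'k::field"
  assumes "finite V"
  obtains A where "A \<in> carrier_mat (card V) (card V)"
    "spectrum A = {k. \<exists>x. (\<exists>u\<in>V. x u \<noteq> 0) \<and> (\<forall>u\<in>V. (\<Sum>v\<in>V. M u v * x v) = k * x u)}"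
proof -
  obtain h where h: "bij_betw h {0..<card V} V"
    using ex_bij_betw_nat_finite[OF assms] by blast
  define n where "n = card V"
  define g where "g = the_inv_into {0..<n} h"
  have hV: "h i \<in> V" if "i < n" for i
    using h that by (auto simp: bij_betw_def n_def)
  have gh: "g (h i) = i" if "i < n" for i
    using h that by (auto simp: bij_betw_def g_def n_def the_inv_into_f_f)
  have hg: "h (g u) = u" "g u < n" if "u \<in> V" for u
  proof -
    have "u \<in> h ` {0..<n}" using h \<open>u \<in> V\<close> by (simp add: bij_betw_def n_def)
    then obtain i where "i < n" "u = h i" by auto
    then show "h (g u) = u" "g u < n" using gh by auto
  qed
  define A where "A = mat n n (\<lambda>(i,j). M (h i) (h j))"
  have A: "A \<in> carrier_mat n n" by (simp add: A_def)
  have sum_h: "(\<Sum>v\<in>V. f v) = (\<Sum>j = 0..<n. f (h j))" for f :: "'a \<Rightarrow> 'k"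
    using sum.reindex_bij_betw[OF h, of f] by (simp add: n_def)
  have row: "(A *\<^sub>v v) $ i = (\<Sum>j = 0..<n. M (h i) (h j) * v $ j)"
    if "v \<in> carrier_vec n" "i < n" for v i
    using that by (simp add: A_def scalar_prod_def)
  have "eigenvalue A k \<longleftrightarrow> (\<exists>x. (\<exists>u\<in>V. x u \<noteq> 0) \<and> (\<forall>u\<in>V. (\<Sum>v\<in>V. M u v * x v) = k * x u))" for k
  proof
    assume "eigenvalue A k"
    then obtain v where v: "v \<in> carrier_vec n" "v \<noteq> 0\<^sub>v n" "A *\<^sub>v v = k \<cdot>\<^sub>v v"
      using A by (auto simp: eigenvalue_def eigenvector_def)
    obtain i where i: "i < n" "v $ i \<noteq> 0"
      using v(1,2) by (metis carrier_vecD eq_vecI index_zero_vec(1) index_zero_vec(2))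
    let ?x = "\<lambda>u. v $ (g u)"
    have "(\<Sum>v\<in>V. M u v * ?x v) = k * ?x u" if "u \<in> V" for u
    proof -
      have "(\<Sum>v\<in>V. M u v * ?x v) = (A *\<^sub>v v) $ (g u)"
        using that by (subst row) (auto simp: v sum_h gh hg)
      then show ?thesis
        using v hg(2)[OF that] by simp
    qed
    moreover have "\<exists>u\<in>V. ?x u \<noteq> 0"
      using i gh hV by metis
    ultimately show "\<exists>x. (\<exists>u\<in>V. x u \<noteq> 0) \<and> (\<forall>u\<in>V. (\<Sum>v\<in>V. M u v * x v) = k * x u)"
      by (intro exI[of _ ?x] conjI ballI)
  next
    assume "\<exists>x. (\<exists>u\<in>V. x u \<noteq> 0) \<and> (\<forall>u\<in>V. (\<Sum>v\<in>V. M u v * x v) = k * x u)"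
    then obtain x where *: "(\<exists>u\<in>V. x u \<noteq> 0) \<and> (\<forall>u\<in>V. (\<Sum>v\<in>V. M u v * x v) = k * x u)"
      by (rule exE)
    then obtain u where x: "u \<in> V" "x u \<noteq> 0"
      "\<And>u. u \<in> V \<Longrightarrow> (\<Sum>v\<in>V. M u v * x v) = k * x u" by auto
    define v where "v = vec n (\<lambda>i. x (h i))"
    have vc: "v \<in> carrier_vec n" by (simp add: v_def)
    have "v $ (g u) \<noteq> 0" using x hg by (simp add: v_def)
    then have "v \<noteq> 0\<^sub>v n" using hg(2)[OF x(1)] by auto
    moreover have "A *\<^sub>v v = k \<cdot>\<^sub>v v"
    proof (rule eq_vecI)
      fix i assume "i < dim_vec (k \<cdot>\<^sub>v v)"
      then have i: "i < n" using vc by simp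
      have "(A *\<^sub>v v) $ i = (\<Sum>j = 0..<n. M (h i) (h j) * x (h j))"
        using row[OF vc i] by (simp add: v_def)
      also have "\<dots> = k * x (h i)"
        using x(3)[OF hV[OF i]] by (simp add: sum_h)
      finally show "(A *\<^sub>v v) $ i = (k \<cdot>\<^sub>v v) $ i" using i by (simp add: v_def)
    qed (use A in \<open>simp add: v_def\<close>)
    ultimately show "eigenvalue A k"
      using A vc by (auto simp: eigenvalue_def eigenvector_def)
  qed
  then have "spectrum A = {k. \<exists>x. (\<exists>u\<in>V. x u \<noteq> 0) \<and> (\<forall>u\<in>V. (\<Sum>v\<in>V. M u v * x v) = k * x u)}"
    unfolding spectrum_def by (intro Collect_cong)
  then show ?thesis
    using that A unfolding n_def by blast
qed

definition nbrs :: "'a set set \<Rightarrow> 'a \<Rightarrow> 'a set" where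
  "nbrs E u = {v. {u, v} \<in> E}"

lemma mem_nbrs [simp]: "v \<in> nbrs E u \<longleftrightarrow> {u, v} \<in> E"
  by (simp add: nbrs_def)

lemma nbrs_sym: "v \<in> nbrs E u \<longleftrightarrow> u \<in> nbrs E v"
  by (simp add: insert_commute)

locale sgraph =
  fixes V :: "'a set" and E :: "'a set set"
  assumes simple: "simple_graph V E"
begin

lemma finite_V [simp, intro]: "finite V"
  using simple by (simp add: simple_graph_def)

lemma edge_in_V: "{u, v} \<in> E \<Longrightarrow> u \<in> V \<and> v \<in> V"
  using simple unfolding simple_graph_def by (metis doubleton_eq_iff)

lemma no_loop [simp]: "{u, u} \<notin> E" "{u} \<notin> E"
  using simple unfolding simple_graph_def by (metis doubleton_eq_iff insert_absorb2)+

lemma edgeE: assumes "e \<in> E" obtains u v where "e = {u, v}" "u \<noteq> v"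
  using simple assms unfolding simple_graph_def by metis

lemma edge_other: "e \<in> E \<Longrightarrow> u \<in> e \<Longrightarrow> \<exists>v. v \<noteq> u \<and> e = {u, v}"
  by (erule edgeE) auto

lemma finite_E [simp, intro]: "finite E"
proof (rule finite_subset)
  show "E \<subseteq> Pow V" using simple by (auto simp: simple_graph_def)
qed simp

lemma nbrs_subset: "nbrs E u \<subseteq> V"
  using edge_in_V by auto

lemma finite_nbrs [simp, intro]: "finite (nbrs E u)"
  using finite_subset[OF nbrs_subset] by simp

lemma nbrs_irrefl [simp]: "u \<notin> nbrs E u" by simp

lemma edges_at: "{e \<in> E. u \<in> e} = (\<lambda>v. {u, v}) ` nbrs E u"
  using edge_other by (fastforce simp: image_iff)

lemma degree_nbrs: "Defs.degree E u = card (nbrs E u)"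
proof -
  have "inj_on (\<lambda>v. {u, v}) (nbrs E u)" by (auto simp: inj_on_def doubleton_eq_iff)
  then show ?thesis by (simp add: Defs.degree_def edges_at card_image)
qed

lemma apply_nbrs:
  "signless_laplacian_apply V E x u = real (card (nbrs E u)) * x u + sum x (nbrs E u)"
proof -
  have "{v \<in> V. {u, v} \<in> E} = nbrs E u" using edge_in_V by auto
  then show ?thesis by (simp add: signless_laplacian_apply_def degree_nbrs)
qed

lemma Q_eigenvalue_nbrs:
  "Q_eigenvalue V E mu \<longleftrightarrow> (\<exists>x. (\<exists>u\<in>V. x u \<noteq> 0) \<and>
     (\<forall>u\<in>V. real (card (nbrs E u)) * x u + sum x (nbrs E u) = mu * x u))"
proof
  assume "\<exists>x. (\<exists>u\<in>V. x u \<noteq> 0) \<and>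
     (\<forall>u\<in>V. real (card (nbrs E u)) * x u + sum x (nbrs E u) = mu * x u)"
  then obtain x where x: "\<exists>u\<in>V. x u \<noteq> 0"
     "\<And>u. u \<in> V \<Longrightarrow> real (card (nbrs E u)) * x u + sum x (nbrs E u) = mu * x u" by blast
  define y where "y u = (if u \<in> V then x u else 0)" for u
  have "sum y (nbrs E u) = sum x (nbrs E u)" for u
    using nbrs_subset by (intro sum.cong) (auto simp: y_def simp del: mem_nbrs)
  then have "(\<forall>u. u \<notin> V \<longrightarrow> y u = 0) \<and> (\<exists>u\<in>V. y u \<noteq> 0) \<and>
          (\<forall>u\<in>V. signless_laplacian_apply V E y u = mu * y u)"
    using x by (simp add: apply_nbrs y_def)
  then show "Q_eigenvalue V E mu" unfolding Q_eigenvalue_def by (intro exI[of _ y])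
qed (auto simp: Q_eigenvalue_def apply_nbrs)

text \<open>Polymorphic in the field: the real matrix gives finiteness of the set of eigenvalues,
  the complex one gives existence.\<close>

abbreviation Qmat :: "'a \<Rightarrow> 'a \<Rightarrow> 'k::field" where
  "Qmat u v \<equiv> (if u = v then of_nat (card (nbrs E u)) else 0) + (if v \<in> nbrs E u then 1 else 0)"

lemma Qmat_sum:
  fixes x :: "'a \<Rightarrow> 'k::field"
  assumes "u \<in> V"
  shows "(\<Sum>v\<in>V. Qmat u v * x v) = of_nat (card (nbrs E u)) * x u + sum x (nbrs E u)"
proof -
  have "(\<Sum>v\<in>V. Qmat u v * x v) = (\<Sum>v\<in>V. if u = v then of_nat (card (nbrs E u)) * x v else 0)
      + (\<Sum>v\<in>V. if v \<in> nbrs E u then x v else 0)"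
    unfolding sum.distrib[symmetric]
    by (rule sum.cong) (auto simp: algebra_simps)
  moreover have "V \<inter> nbrs E u = nbrs E u" using nbrs_subset by blast
  ultimately show ?thesis
    using assms by (simp add: sum.inter_restrict[symmetric] del: mem_nbrs)
qed

lemma finite_Q_eigenvalues: "finite {mu. Q_eigenvalue V E mu}"
proof -
  obtain A :: "real mat" where A: "A \<in> carrier_mat (card V) (card V)"
    "spectrum A = {k. \<exists>x. (\<exists>u\<in>V. x u \<noteq> 0) \<and> (\<forall>u\<in>V. (\<Sum>v\<in>V. Qmat u v * x v) = k * x u)}"
    by (rule spectrum_indexed[OF finite_V])
  have "{mu. Q_eigenvalue V E mu} = spectrum A"
    unfolding A(2) Q_eigenvalue_nbrs using Qmat_sum[where 'k = real] by (simp del: mem_nbrs cong: conj_cong ball_cong)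
  then show ?thesis using card_finite_spectrum(1)[OF A(1)] by simp
qed

lemma sum_nbrs_symmetric:
  fixes f :: "'a \<Rightarrow> 'a \<Rightarrow> real"
  shows "(\<Sum>u\<in>V. \<Sum>v\<in>nbrs E u. f u v) = (\<Sum>u\<in>V. \<Sum>v\<in>nbrs E u. f v u)"
proof -
  have *: "V \<inter> nbrs E u = nbrs E u" for u using nbrs_subset by blast
  have "(\<Sum>u\<in>V. \<Sum>v\<in>nbrs E u. f u v) = (\<Sum>u\<in>V. \<Sum>v\<in>V. if v \<in> nbrs E u then f u v else 0)"
    by (simp add: sum.inter_restrict[symmetric] * del: mem_nbrs)
  also have "\<dots> = (\<Sum>v\<in>V. \<Sum>u\<in>V. if v \<in> nbrs E u then f u v else 0)" by (rule sum.swap)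
  also have "\<dots> = (\<Sum>v\<in>V. \<Sum>u\<in>V. if u \<in> nbrs E v then f u v else 0)"
    by (subst nbrs_sym) (rule refl)
  also have "\<dots> = (\<Sum>u\<in>V. \<Sum>v\<in>nbrs E u. f v u)"
    by (simp add: sum.inter_restrict[symmetric] * del: mem_nbrs)
  finally show ?thesis .
qed

text \<open>An eigenvalue k exists over the complex numbers, and symmetry of Q makes it real: for an
  eigenvector a + i b, equating b . Q a with a . Q b gives Im k times the squared norm of the vector
  equal to 0. Then a or b, whichever is nonzero, is a real eigenvector.\<close>

lemma ex_Q_eigenvalue:
  assumes "V \<noteq> {}" shows "\<exists>mu. Q_eigenvalue V E mu"
proof -
  obtain A :: "complex mat" where A: "A \<in> carrier_mat (card V) (card V)"
    "spectrum A = {k. \<exists>x. (\<exists>u\<in>V. x u \<noteq> 0) \<and> (\<forall>u\<in>V. (\<Sum>v\<in>V. Qmat u v * x v) = k * x u)}"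
    by (rule spectrum_indexed[OF finite_V])
  have "spectrum A \<noteq> {}"
    using spectrum_non_empty[OF A(1)] assms by (simp add: card_gt_0_iff)
  then obtain k where "k \<in> spectrum A" by blast
  then obtain x where "(\<exists>u\<in>V. x u \<noteq> 0) \<and> (\<forall>u\<in>V. (\<Sum>v\<in>V. Qmat u v * x v) = k * x u)"
    unfolding A(2) mem_Collect_eq by (rule exE)
  then have x: "\<exists>u\<in>V. x u \<noteq> 0"
    "\<And>u. u \<in> V \<Longrightarrow> of_nat (card (nbrs E u)) * x u + sum x (nbrs E u) = k * x u"
    by (simp_all add: Qmat_sum del: mem_nbrs)
  define a b where "a = (\<lambda>u. Re (x u))" and "b = (\<lambda>u. Im (x u))"
  define d where "d u = real (card (nbrs E u))" for u
  have a: "d u * a u + sum a (nbrs E u) = Re k * a u - Im k * b u" if "u \<in> V" for u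
    using arg_cong[OF x(2)[OF that], of Re] by (simp add: a_def b_def d_def Re_sum)
  have b: "d u * b u + sum b (nbrs E u) = Re k * b u + Im k * a u" if "u \<in> V" for u
    using arg_cong[OF x(2)[OF that], of Im] by (simp add: a_def b_def d_def Im_sum)
  have ab: "b u \<noteq> 0 \<or> a u \<noteq> 0" if "x u \<noteq> 0" for u
    using that by (auto simp: a_def b_def complex_eq_iff)
  have "(\<Sum>u\<in>V. b u * (d u * a u + sum a (nbrs E u)))
      = (\<Sum>u\<in>V. d u * a u * b u) + (\<Sum>u\<in>V. \<Sum>v\<in>nbrs E u. b u * a v)"
    by (simp add: algebra_simps sum.distrib sum_distrib_left)
  also have "\<dots> = (\<Sum>u\<in>V. d u * a u * b u) + (\<Sum>u\<in>V. \<Sum>v\<in>nbrs E u. b v * a u)"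
    by (subst sum_nbrs_symmetric) (rule refl)
  also have "\<dots> = (\<Sum>u\<in>V. a u * (d u * b u + sum b (nbrs E u)))"
    by (simp add: algebra_simps sum.distrib sum_distrib_left)
  finally have "(\<Sum>u\<in>V. b u * (Re k * a u - Im k * b u)) = (\<Sum>u\<in>V. a u * (Re k * b u + Im k * a u))"
    by (simp add: a b)
  then have "0 = (\<Sum>u\<in>V. a u * (Re k * b u + Im k * a u) - b u * (Re k * a u - Im k * b u))"
    by (simp add: sum_subtractf)
  also have "\<dots> = Im k * (\<Sum>u\<in>V. a u ^ 2 + b u ^ 2)"
    unfolding sum_distrib_left by (rule sum.cong) (simp_all add: algebra_simps power2_eq_square)
  finally have "Im k = 0 \<or> (\<Sum>u\<in>V. a u ^ 2 + b u ^ 2) = 0" by simp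
  moreover have "(\<Sum>u\<in>V. a u ^ 2 + b u ^ 2) \<noteq> 0"
  proof
    assume "(\<Sum>u\<in>V. a u ^ 2 + b u ^ 2) = 0"
    then have "\<forall>u\<in>V. a u ^ 2 + b u ^ 2 = 0" by (subst (asm) sum_nonneg_eq_0_iff) auto
    then show False using x(1) ab by (auto simp: sum_power2_eq_zero_iff)
  qed
  ultimately have "Im k = 0" by blast
  then have a': "\<forall>u\<in>V. real (card (nbrs E u)) * a u + sum a (nbrs E u) = Re k * a u"
    and b': "\<forall>u\<in>V. real (card (nbrs E u)) * b u + sum b (nbrs E u) = Re k * b u"
    using a b by (simp_all add: d_def)
  have "Q_eigenvalue V E (Re k)"
  proof (cases "\<exists>u\<in>V. a u \<noteq> 0")
    case True
    with a' show ?thesis unfolding Q_eigenvalue_nbrs by (intro exI[of _ a] conjI)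
  next
    case False
    with x(1) ab have "\<exists>u\<in>V. b u \<noteq> 0" by auto
    with b' show ?thesis unfolding Q_eigenvalue_nbrs by (intro exI[of _ b] conjI)
  qed
  then show ?thesis ..
qed

lemma q_radius_less_iff:
  assumes "V \<noteq> {}"
  shows "q_radius V E < r \<longleftrightarrow> (\<forall>mu. Q_eigenvalue V E mu \<longrightarrow> mu < r)"
  using finite_Q_eigenvalues ex_Q_eigenvalue[OF assms]
  by (auto simp: q_radius_def Max_less_iff)

lemma q_radius_eqI:
  assumes "Q_eigenvalue V E r" "\<And>mu. Q_eigenvalue V E mu \<Longrightarrow> mu \<le> r"
  shows "q_radius V E = r"
  unfolding q_radius_def using assms finite_Q_eigenvalues by (intro Max_eqI) auto

text \<open>A positive vector \<open>y\<close> with \<open>Q y \<le> r y\<close> bounds all eigenvalues. If \<open>r\<close> were attained, the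
  vertices maximising \<open>\<bar>x\<bar> / y\<close> for an eigenvector \<open>x\<close> would form a union of components on which
  \<open>Q y = r y\<close>.\<close>

lemma eigenvalue_bound:
  assumes pos: "\<And>w. w \<in> V \<Longrightarrow> y w > 0"
    and sup: "\<And>w. w \<in> V \<Longrightarrow> real (card (nbrs E w)) * y w + sum y (nbrs E w) \<le> r * y w"
    and mu: "Q_eigenvalue V E mu"
  shows "mu \<le> r"
    and "(\<And>w. w \<in> V \<Longrightarrow> \<exists>w'. (\<lambda>s t. {s, t} \<in> E)\<^sup>*\<^sup>* w w' \<and>
            real (card (nbrs E w')) * y w' + sum y (nbrs E w') < r * y w') \<Longrightarrow> mu < r"
proof -
  obtain x where "(\<exists>u\<in>V. x u \<noteq> 0) \<and>
     (\<forall>u\<in>V. real (card (nbrs E u)) * x u + sum x (nbrs E u) = mu * x u)"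
    using mu unfolding Q_eigenvalue_nbrs by (rule exE)
  then have x: "\<exists>u\<in>V. x u \<noteq> 0"
    "\<And>u. u \<in> V \<Longrightarrow> real (card (nbrs E u)) * x u + sum x (nbrs E u) = mu * x u"
    by simp_all
  define z where "z u = \<bar>x u\<bar> / y u" for u
  define M where "M = Max (z ` V)"
  have zM: "z u \<le> M" if "u \<in> V" for u using that by (auto simp: M_def)
  have Vne: "V \<noteq> {}" using x(1) by auto
  have "M \<in> z ` V" unfolding M_def using Vne by (intro Max_in) auto
  then obtain w0 where w0: "w0 \<in> V" "z w0 = M" by auto
  have Mpos: "M > 0"
  proof -
    obtain u where u: "u \<in> V" "x u \<noteq> 0" using x(1) by blast
    then have "z u > 0" using pos by (simp add: z_def)
    then show ?thesis using zM[OF u(1)] by linarith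
  qed
  have xy: "\<bar>x u\<bar> \<le> M * y u" if "u \<in> V" for u
    using zM[OF that] pos[OF that] by (simp add: z_def field_simps)
  have ext: "mu * (M * y w) \<le> real (card (nbrs E w)) * (M * y w) + (\<Sum>v\<in>nbrs E w. \<bar>x v\<bar>)"
    if w: "w \<in> V" "z w = M" for w
  proof -
    have e: "\<bar>x w\<bar> = M * y w" using w pos[OF w(1)] by (simp add: z_def field_simps)
    have "mu * \<bar>x w\<bar> \<le> \<bar>mu * x w\<bar>" by (simp add: abs_mult mult_right_mono)
    also have "\<dots> \<le> real (card (nbrs E w)) * \<bar>x w\<bar> + \<bar>sum x (nbrs E w)\<bar>"
      unfolding x(2)[OF w(1), symmetric] by (rule order.trans[OF abs_triangle_ineq]) (simp add: abs_mult)
    also have "\<dots> \<le> real (card (nbrs E w)) * \<bar>x w\<bar> + (\<Sum>v\<in>nbrs E w. \<bar>x v\<bar>)" by simp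
    finally show ?thesis by (simp only: e)
  qed
  have le: "(\<Sum>v\<in>nbrs E w. \<bar>x v\<bar>) \<le> M * sum y (nbrs E w)" for w
    unfolding sum_distrib_left using nbrs_subset by (intro sum_mono xy) blast
  have ext': "mu * (M * y w) \<le> M * (real (card (nbrs E w)) * y w + sum y (nbrs E w))"
    if w: "w \<in> V" "z w = M" for w
    using ext[OF w] le[of w] by (simp add: algebra_simps)
  have bnd: "mu * y w \<le> real (card (nbrs E w)) * y w + sum y (nbrs E w)"
    if w: "w \<in> V" "z w = M" for w
  proof -
    have "M * (mu * y w) \<le> M * (real (card (nbrs E w)) * y w + sum y (nbrs E w))"
      using ext'[OF w] by (simp add: algebra_simps)
    then show ?thesis using Mpos by simp
  qed
  show "mu \<le> r"
    using bnd[OF w0] sup[OF w0(1)] pos[OF w0(1)] by (meson mult_le_cancel_right_pos order.trans)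
  show "mu < r" if str: "\<And>w. w \<in> V \<Longrightarrow> \<exists>w'. (\<lambda>s t. {s, t} \<in> E)\<^sup>*\<^sup>* w w' \<and>
            real (card (nbrs E w')) * y w' + sum y (nbrs E w') < r * y w'"
  proof (rule ccontr)
    assume "\<not> mu < r"
    then have r: "mu = r" using \<open>mu \<le> r\<close> by simp
    have propagate: "v \<in> V \<and> z v = M" if w: "w \<in> V" "z w = M" and v: "{w, v} \<in> E" for w v
    proof (rule ccontr)
      assume neg: "\<not> (v \<in> V \<and> z v = M)"
      have vV: "v \<in> V" using v edge_in_V by blast
      then have "z v < M" using neg zM by (simp add: order.strict_iff_order)
      then have less: "\<bar>x v\<bar> < M * y v" using pos[OF vV] by (simp add: z_def field_simps)
      have "(\<Sum>v\<in>nbrs E w. \<bar>x v\<bar>) < (\<Sum>v\<in>nbrs E w. M * y v)"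
      proof (rule sum_strict_mono_ex1)
        show "\<forall>v\<in>nbrs E w. \<bar>x v\<bar> \<le> M * y v" using nbrs_subset[of w] xy by blast
        show "\<exists>v\<in>nbrs E w. \<bar>x v\<bar> < M * y v" using v less by auto
      qed simp
      then have "mu * (M * y w) < M * (real (card (nbrs E w)) * y w + sum y (nbrs E w))"
        using ext[OF w] by (simp add: algebra_simps sum_distrib_left)
      also have "\<dots> \<le> M * (r * y w)"
        using sup[OF w(1)] Mpos by simp
      finally show False using r by (simp add: algebra_simps)
    qed
    obtain w' where w': "(\<lambda>s t. {s, t} \<in> E)\<^sup>*\<^sup>* w0 w' \<and>
        real (card (nbrs E w')) * y w' + sum y (nbrs E w') < r * y w'" using str[OF w0(1)] by (rule exE)
    from conjunct1[OF w'] have "w' \<in> V \<and> z w' = M"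
    proof (induction rule: rtranclp_induct)
      case base show ?case using w0 by simp
    next
      case (step s t) then show ?case using propagate[of s t] by simp
    qed
    then show False using bnd[of w'] conjunct2[OF w'] r by simp
  qed
qed

end

section \<open>The graphs \<open>S\<^bsub>a,b,c\<^esub>\<close>\<close>

lemma graph_iso_sym:
  assumes "graph_iso V1 E1 V2 E2" shows "graph_iso V2 E2 V1 E1"
proof -
  obtain f where f: "bij_betw f V1 V2"
    "\<And>u v. u \<in> V1 \<Longrightarrow> v \<in> V1 \<Longrightarrow> {u, v} \<in> E1 \<longleftrightarrow> {f u, f v} \<in> E2"
    using assms by (auto simp: graph_iso_def)
  let ?g = "the_inv_into V1 f"
  have g: "bij_betw ?g V2 V1" using f(1) by (rule bij_betw_the_inv_into)
  have "f (?g u) = u" "?g u \<in> V1" if "u \<in> V2" for u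
    using f(1) g that f_the_inv_into_f_bij_betw[of f V1 V2 u] by (auto simp: bij_betw_def)
  then show ?thesis unfolding graph_iso_def using g f(2)
    by (intro exI[of _ ?g]) simp
qed

lemma Q_eigenvalue_graph_iso:
  assumes "simple_graph V1 E1" "simple_graph V2 E2" "graph_iso V1 E1 V2 E2"
    "Q_eigenvalue V2 E2 mu"
  shows "Q_eigenvalue V1 E1 mu"
proof -
  interpret G1: sgraph V1 E1 by unfold_locales fact
  interpret G2: sgraph V2 E2 by unfold_locales fact
  obtain f where f: "bij_betw f V1 V2"
    "\<And>u v. u \<in> V1 \<Longrightarrow> v \<in> V1 \<Longrightarrow> {u, v} \<in> E1 \<longleftrightarrow> {f u, f v} \<in> E2"
    using assms(3) by (auto simp: graph_iso_def)
  have inj: "inj_on f V1" and im: "f ` V1 = V2" using f(1) by (auto simp: bij_betw_def)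
  have nb: "nbrs E2 (f u) = f ` nbrs E1 u" if "u \<in> V1" for u
  proof (intro Set.set_eqI iffI)
    fix w assume "w \<in> nbrs E2 (f u)"
    then have w: "{f u, w} \<in> E2" by simp
    then obtain v where v: "v \<in> V1" "w = f v" using G2.edge_in_V im by blast
    then show "w \<in> f ` nbrs E1 u" using f(2)[OF that v(1)] w by simp
  next
    fix w assume "w \<in> f ` nbrs E1 u"
    then obtain v where v: "{u, v} \<in> E1" "w = f v" by auto
    then have "v \<in> V1" using G1.edge_in_V by blast
    then show "w \<in> nbrs E2 (f u)" using f(2)[OF that] v by simp
  qed
  have inj': "inj_on f (nbrs E1 u)" for u by (rule inj_on_subset[OF inj G1.nbrs_subset])
  obtain x where x: "(\<exists>u\<in>V2. x u \<noteq> 0) \<and>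
     (\<forall>u\<in>V2. real (card (nbrs E2 u)) * x u + sum x (nbrs E2 u) = mu * x u)"
    using assms(4) unfolding G2.Q_eigenvalue_nbrs by (rule exE)
  have "real (card (nbrs E1 u)) * x (f u) + sum (x \<circ> f) (nbrs E1 u) = mu * x (f u)"
    if "u \<in> V1" for u
  proof -
    have "f u \<in> V2" using im that by blast
    then have "real (card (nbrs E2 (f u))) * x (f u) + sum x (nbrs E2 (f u)) = mu * x (f u)"
      using x by blast
    then show ?thesis
      unfolding nb[OF that] card_image[OF inj'] sum.reindex[OF inj'] .
  qed
  moreover have "\<exists>u\<in>V1. (x \<circ> f) u \<noteq> 0" using x im by auto
  ultimately show ?thesis unfolding G1.Q_eigenvalue_nbrs
    by (intro exI[of _ "x \<circ> f"] conjI) simp_all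
qed

lemma q_radius_graph_iso:
  assumes "simple_graph V1 E1" "simple_graph V2 E2" "graph_iso V1 E1 V2 E2"
  shows "q_radius V1 E1 = q_radius V2 E2"
proof -
  have "Q_eigenvalue V1 E1 mu \<longleftrightarrow> Q_eigenvalue V2 E2 mu" for mu
    using Q_eigenvalue_graph_iso[OF assms] graph_iso_sym[OF assms(3)]
      Q_eigenvalue_graph_iso[OF assms(2,1)] by blast
  then show ?thesis by (simp add: q_radius_def)
qed

text \<open>The map runs from the named vertices of the model into the graph, so that the edges of
  the graph can be described as images. With \<open>sub\<close>, injectivity recovers an edge from
  its image.\<close>

lemma graph_isoI:
  assumes inj: "inj_on g V'" and V: "V = g ` V'" and E: "E = (`) g ` E'" and sub: "E' \<subseteq> Pow V'"
  shows "graph_iso V E V' E'"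
proof (rule graph_iso_sym)
  have "{u, v} \<in> E' \<longleftrightarrow> {g u, g v} \<in> E" if "u \<in> V'" "v \<in> V'" for u v
  proof
    assume "{g u, g v} \<in> E"
    then obtain e where e: "e \<in> E'" "g ` {u, v} = g ` e" unfolding E by auto
    then have "{u, v} = e"
      using inj_on_image_eq_iff[OF inj, of "{u, v}" e] sub that by blast
    then show "{u, v} \<in> E'" using e by simp
  next
    assume "{u, v} \<in> E'"
    then have "g ` {u, v} \<in> E" unfolding E by (rule imageI)
    then show "{g u, g v} \<in> E" by simp
  qed
  then show "graph_iso V' E' V E"
    using inj V by (auto simp: graph_iso_def bij_betw_def)
qed

section \<open>Neighbourhoods, eigenvector entries and largest eigenvalue\<close>

lemma simple_graph_S_ext: "simple_graph (S_ext_V a b c k l) (S_ext_E a b c k l)"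
proof -
  have "\<exists>u v. u \<in> S_ext_V a b c k l \<and> v \<in> S_ext_V a b c k l \<and> u \<noteq> v \<and> e = {u, v}"
    if "e \<in> S_ext_E a b c k l" for e
    using that unfolding S_ext_E_def
    by (elim UnE imageE; simp only:; intro exI conjI; (rule refl)?; simp add: S_ext_V_def)
  then show ?thesis by (simp add: simple_graph_def) (simp add: S_ext_V_def)
qed

interpretation S: sgraph "S_ext_V a b c k l" "S_ext_E a b c k l"
  by unfold_locales (rule simple_graph_S_ext)

lemma nbrs_S_ext:
  "nbrs (S_ext_E a b c k l) Center = Pend ` {..<a} \<union> PMid ` {..<b} \<union> TriA ` {..<c} \<union> TriB ` {..<c}"
  "nbrs (S_ext_E a b c k l) (Pend i) = (if i < a then {Center} else {})"
  "nbrs (S_ext_E a b c k l) (PMid i) = (if i < b then {Center, PEnd i} else {})"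
  "nbrs (S_ext_E a b c k l) (PEnd i) = (if i < b then {PMid i} else {})"
  "nbrs (S_ext_E a b c k l) (TriA i) = (if i < c then {Center, TriB i} else {})"
  "nbrs (S_ext_E a b c k l) (TriB i) = (if i < c then {Center, TriA i} else {})"
  "nbrs (S_ext_E a b c k l) (IsoE1 i) = (if i < k then {IsoE2 i} else {})"
  "nbrs (S_ext_E a b c k l) (IsoE2 i) = (if i < k then {IsoE1 i} else {})"
  "nbrs (S_ext_E a b c k l) (IsoV i) = {}"
  by (rule Set.set_eqI, rename_tac t, case_tac t;
      simp add: S_ext_E_def image_iff doubleton_eq_iff; blast?)+

text \<open>The entries, relative to the centre, of an eigenvector of \<open>S\<^bsub>a,b,c\<^esub>\<close> for the eigenvalue \<open>r\<close>: at a
  pendant vertex, at the middle and the end of a pendant path, and at a triangle vertex.\<close>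

definition pend_wt :: "real \<Rightarrow> real" where "pend_wt r = 1 / (r - 1)"
definition path_wt :: "real \<Rightarrow> real" where "path_wt r = (r - 1) / (r\<^sup>2 - 3 * r + 1)"
definition end_wt :: "real \<Rightarrow> real" where "end_wt r = 1 / (r\<^sup>2 - 3 * r + 1)"
definition tri_wt :: "real \<Rightarrow> real" where "tri_wt r = 1 / (r - 3)"

lemma quad_pos: "r > 3 \<Longrightarrow> r\<^sup>2 - 3 * r + 1 > (0::real)"
proof -
  assume "r > 3"
  then have "r * (r - 3) > 0" by simp
  then show ?thesis by (simp add: power2_eq_square algebra_simps)
qed

lemma wt_pos:
  "r > 1 \<Longrightarrow> pend_wt r > 0" "r > 3 \<Longrightarrow> path_wt r > 0" "r > 3 \<Longrightarrow> end_wt r > 0"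
  "r > 3 \<Longrightarrow> tri_wt r > 0"
  using quad_pos by (auto simp: pend_wt_def path_wt_def end_wt_def tri_wt_def)

text \<open>These are the eigenvalue equations at the vertices other than the centre, which has
  entry 1. The denominator \<open>r\<^sup>2 - 3 * r + 1\<close> is (r - 2) * (r - 1) - 1, the
  determinant of the two equations of a pendant path.\<close>

lemma wt_eqs:
  "r > 1 \<Longrightarrow> pend_wt r + 1 = r * pend_wt r"
  "r > 3 \<Longrightarrow> 2 * path_wt r + (1 + end_wt r) = r * path_wt r"
  "r > 3 \<Longrightarrow> end_wt r + path_wt r = r * end_wt r"
  "r > 3 \<Longrightarrow> 2 * tri_wt r + (1 + tri_wt r) = r * tri_wt r"
  using quad_pos[of r]
  by (simp_all add: pend_wt_def path_wt_def end_wt_def tri_wt_def divide_simps power2_eq_square)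
     (simp_all add: algebra_simps)

lemma wt_mono:
  assumes "r > 3" shows "pend_wt r < path_wt r" "path_wt r < tri_wt r"
  using assms quad_pos[OF assms]
  by (simp_all add: pend_wt_def path_wt_def tri_wt_def divide_simps power2_eq_square)
     (simp_all add: algebra_simps)

text \<open>The sum of the entries over the neighbours of the centre; a triangle contributes two
  neighbours.\<close>

definition S_sum :: "nat \<Rightarrow> nat \<Rightarrow> nat \<Rightarrow> real \<Rightarrow> real" where
  "S_sum a b c r = a * pend_wt r + b * path_wt r + 2 * c * tri_wt r"

lemma sum_nbrs_Center:
  "sum x (nbrs (S_ext_E a b c k l) Center) =
     (\<Sum>i<a. x (Pend i)) + (\<Sum>i<b. x (PMid i)) + (\<Sum>i<c. x (TriA i)) + (\<Sum>i<c. x (TriB i))"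
  unfolding nbrs_S_ext
  by (subst sum.union_disjoint; (auto simp: sum.reindex inj_on_def)[1])+

lemma card_nbrs_Center: "card (nbrs (S_ext_E a b c k l) Center) = a + b + 2 * c"
  using sum_nbrs_Center[of "\<lambda>_. 1::nat" a b c k l] by simp

text \<open>The hypothesis \<open>root\<close> is the eigenvalue equation at the centre.\<close>

lemma S_ext_q_radius:
  assumes root: "r = real (a + b + 2 * c) + S_sum a b c r"
    and r2: "r \<ge> 2" and r3: "b > 0 \<or> c > 0 \<Longrightarrow> r > 3"
  shows "q_radius (S_ext_V a b c k l) (S_ext_E a b c k l) = r"
proof (rule S.q_radius_eqI)
  let ?E = "S_ext_E a b c k l" and ?V = "S_ext_V a b c k l"
  \<comment> \<open>\<open>t\<close> is the entry on the isolated edges and vertices.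
    \<open>y 0\<close> is an eigenvector for r; \<open>y 1\<close> is positive everywhere and bounds
    all eigenvalues, the isolated edges requiring r \<ge> 2.\<close>
  define y where "y t s = (case s of Center \<Rightarrow> 1 | Pend i \<Rightarrow> pend_wt r | PMid i \<Rightarrow> path_wt r
    | PEnd i \<Rightarrow> end_wt r | TriA i \<Rightarrow> tri_wt r | TriB i \<Rightarrow> tri_wt r | _ \<Rightarrow> t)" for t s
  have r1: "r > 1" using r2 by simp
  have eq: "real (card (nbrs ?E s)) * y t s + sum (y t) (nbrs ?E s) = r * y t s"
    if "s \<in> ?V" "s \<in> {Center} \<union> range Pend \<union> range PMid \<union> range PEnd \<union> range TriA \<union> range TriB" for s t
    using that
  proof (cases s)
    case Center
    have "real (card (nbrs ?E s)) * y t s + sum (y t) (nbrs ?E s) = real (a + b + 2 * c) + S_sum a b c r"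
      unfolding Center card_nbrs_Center sum_nbrs_Center by (simp add: y_def S_sum_def)
    then show ?thesis using root Center by (simp add: y_def)
  qed (use wt_eqs[of r] r1 r3 in \<open>auto simp: y_def nbrs_S_ext S_ext_V_def simp del: mem_nbrs\<close>)
  show "Q_eigenvalue ?V ?E r"
    unfolding S.Q_eigenvalue_nbrs
  proof (intro exI[of _ "y 0"] conjI ballI bexI[of _ Center])
    fix s assume s: "s \<in> ?V"
    show "real (card (nbrs ?E s)) * y 0 s + sum (y 0) (nbrs ?E s) = r * y 0 s"
      using eq[OF s] by (cases s) (auto simp: y_def nbrs_S_ext simp del: mem_nbrs)
  qed (auto simp: y_def S_ext_V_def)
  fix mu assume mu: "Q_eigenvalue ?V ?E mu"
  show "mu \<le> r"
  proof (rule S.eigenvalue_bound(1)[OF _ _ mu])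
    fix s assume s: "s \<in> ?V"
    show "y 1 s > 0"
      using s wt_pos[of r] r1 r3 by (cases s) (auto simp: y_def S_ext_V_def)
    show "real (card (nbrs ?E s)) * y 1 s + sum (y 1) (nbrs ?E s) \<le> r * y 1 s"
      using eq[OF s, of 1] r2 by (cases s) (auto simp: y_def nbrs_S_ext simp del: mem_nbrs)
  qed
qed

text \<open>A star with t + 1 edges has q = t + 2: giving all t + 1 neighbours of the centre the
  weight \<open>pend_wt\<close> makes the equation exact at r = t + 2. A path or a triangle weighs
  strictly more, which pushes the root beyond t + 2.\<close>

lemma ex_root:
  assumes "a + b + 2 * c = t + 1" "t \<ge> 1" "b > 0 \<or> c > 0" "t = 1 \<Longrightarrow> a = 1 \<and> b = 1 \<and> c = 0"
  shows "\<exists>r. r = real (t + 1) + S_sum a b c r \<and> r > 3 \<and> r > real t + 2"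
proof -
  define h where "h r = r - real (t + 1) - S_sum a b c r" for r
  \<comment> \<open>For t = 1 the graph is a path on four vertices with q = 2 + sqrt 2. The natural
    left end t + 2 = 3 is not admissible in \<open>wt_mono\<close>, so a point between 3 and the
    root is taken.\<close>
  define L where "L = (if t = 1 then 31/10 else real t + 2)"
  have L3: "L > 3" using assms(2) by (auto simp: L_def)
  have mono: "pend_wt L < path_wt L" "pend_wt L < tri_wt L" using wt_mono[OF L3] by auto
  have "h L < 0"
  proof (cases "t = 1")
    case True
    then show ?thesis using assms(4)
      by (simp add: h_def L_def S_sum_def pend_wt_def path_wt_def power2_eq_square)
  next
    case False
    then have L: "L = real t + 2" by (simp add: L_def)
    have "real b * pend_wt L \<le> b * path_wt L" "real c * pend_wt L \<le> c * tri_wt L"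
      using mono by (simp_all add: mult_left_mono)
    moreover have "real b * pend_wt L < b * path_wt L \<or> real c * pend_wt L < c * tri_wt L"
      using assms(3) mono by auto
    ultimately have "real (a + b + 2 * c) * pend_wt L < S_sum a b c L"
      unfolding S_sum_def by (auto simp: algebra_simps)
    moreover have "real (a + b + 2 * c) * pend_wt L = 1"
      unfolding assms(1) L pend_wt_def by simp
    ultimately show ?thesis by (simp add: h_def L)
  qed
  \<comment> \<open>From 6 on all weights are at most 1, so \<open>S_sum\<close> is at most t + 1
    and \<open>h U\<close> is at least 2.\<close>
  define U where "U = 2 * real t + 4"
  have U: "U \<ge> 6" "L \<le> U" using assms(2) by (auto simp: U_def L_def)
  have "pend_wt U \<le> 1" "path_wt U \<le> 1" "tri_wt U \<le> 1"
  proof -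
    have "4 * U \<le> U\<^sup>2" using U by (simp add: power2_eq_square)
    then have "U - 1 \<le> U\<^sup>2 - 3 * U + 1" by linarith
    then show "path_wt U \<le> 1" using quad_pos[of U] U by (simp add: path_wt_def)
  qed (use U in \<open>simp_all add: pend_wt_def tri_wt_def\<close>)
  then have "S_sum a b c U \<le> real (a + b + 2 * c)"
    unfolding S_sum_def by (simp add: add_mono mult_left_le)
  then have hU: "h U > 0" unfolding assms(1) by (simp add: h_def U_def)
  have "continuous_on {L..U} h"
    unfolding h_def S_sum_def pend_wt_def path_wt_def tri_wt_def
    using L3 quad_pos by (intro continuous_intros) (auto simp: less_imp_neq[symmetric] dest!: order.strict_trans2)
  then obtain r where r: "L \<le> r" "r \<le> U" "h r = 0"
    using IVT'[of h L 0 U] \<open>h L < 0\<close> hU U by auto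
  have "r \<noteq> L" using r \<open>h L < 0\<close> by auto
  then show ?thesis using r L3 assms(2)
    by (intro exI[of _ r]) (auto simp: h_def L_def split: if_splits)
qed

section \<open>Graphs with a hub\<close>

lemma disjoint_edges_enumeration:
  assumes fin: "finite F" and pair: "\<And>e. e \<in> F \<Longrightarrow> \<exists>x y. x \<noteq> y \<and> e = {x, y}"
    and disj: "\<And>e f. e \<in> F \<Longrightarrow> f \<in> F \<Longrightarrow> e \<inter> f \<noteq> {} \<Longrightarrow> e = f"
  obtains x y where "F = (\<lambda>i. {x i, y i}) ` {..<card F}"
    "\<And>i. i < card F \<Longrightarrow> x i \<noteq> y i"
    "\<And>i j. i < card F \<Longrightarrow> j < card F \<Longrightarrow> {x i, y i} \<inter> {x j, y j} \<noteq> {} \<Longrightarrow> i = j"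
proof -
  obtain h where h: "bij_betw h {..<card F} F"
    using ex_bij_betw_nat_finite[OF fin] by (auto simp: atLeast0LessThan)
  have hF: "h i \<in> F" if "i < card F" for i using h that by (auto simp: bij_betw_def)
  have "\<forall>i. \<exists>x y. i < card F \<longrightarrow> x \<noteq> y \<and> h i = {x, y}" using pair hF by blast
  then obtain x y where xy: "\<And>i. i < card F \<Longrightarrow> x i \<noteq> y i \<and> h i = {x i, y i}"
    by metis
  show thesis
  proof (rule that)
    have "h ` {..<card F} = (\<lambda>i. {x i, y i}) ` {..<card F}"
      using xy by (intro image_cong) auto
    then show "F = (\<lambda>i. {x i, y i}) ` {..<card F}" using h by (simp add: bij_betw_def)
    fix i j assume ij: "i < card F" "j < card F" "{x i, y i} \<inter> {x j, y j} \<noteq> {}"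
    then have "h i = h j" using xy hF by (intro disj) auto
    then show "i = j" using h ij by (auto simp: bij_betw_def inj_on_def)
  qed (use xy in blast)
qed

text \<open>The vertex \<open>u\<close> plays the role of the centre of \<open>S\<^bsub>a,b,c\<^esub>\<close>: outside a set \<open>B\<close>, which is
  attached to the rest only through \<open>u\<close>, removing \<open>u\<close> leaves isolated vertices and edges.\<close>

locale hub = sgraph +
  fixes u :: 'a and B :: "'a set"
  assumes u_in_V: "u \<in> V" and u_notin_B: "u \<notin> B"
    and B_closed: "\<And>w x. w \<in> B \<Longrightarrow> {w, x} \<in> E \<Longrightarrow> x \<noteq> u \<Longrightarrow> x \<in> B"
    and rest_matching: "\<And>w x y. w \<noteq> u \<Longrightarrow> w \<notin> B \<Longrightarrow> {w, x} \<in> E \<Longrightarrow> {w, y} \<in> E \<Longrightarrow> x \<noteq> u \<Longrightarrow> y \<noteq> u \<Longrightarrow> x = y"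
begin

section \<open>Types of neighbours of the hub\<close>

definition rest_edges where "rest_edges = {e \<in> E. u \<notin> e \<and> e \<inter> B = {}}"
definition pends where "pends = {w \<in> nbrs E u - B. nbrs E w = {u}}"
definition mids where "mids = {w \<in> nbrs E u - B. \<exists>x. x \<noteq> u \<and> {w, x} \<in> E \<and> {u, x} \<notin> E}"
text \<open>A triangle is represented by its side opposite to u, so the number of these edges is the
  parameter c.\<close>

definition tri_edges where "tri_edges = {e \<in> rest_edges. e \<subseteq> nbrs E u}"
definition partner where "partner w = (THE x. x \<noteq> u \<and> {w, x} \<in> E)"

lemma B_closed': "w \<notin> B \<Longrightarrow> {w, x} \<in> E \<Longrightarrow> w \<noteq> u \<Longrightarrow> x \<notin> B"
  using B_closed[of x w] by (auto simp: insert_commute)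

lemma partner_eq: "w \<noteq> u \<Longrightarrow> w \<notin> B \<Longrightarrow> {w, x} \<in> E \<Longrightarrow> x \<noteq> u \<Longrightarrow> partner w = x"
  unfolding partner_def by (rule the_equality) (auto intro: rest_matching)

lemma nbrs_eq_pair:
  assumes "{u, w} \<in> E" "w \<notin> B" "{w, x} \<in> E" "x \<noteq> u"
  shows "nbrs E w = {u, x}"
proof (intro Set.set_eqI iffI)
  have "w \<noteq> u" "{w, u} \<in> E" using assms(1) by (auto simp: insert_commute)
  fix y
  show "y \<in> {u, x}" if "y \<in> nbrs E w"
    using that rest_matching[OF \<open>w \<noteq> u\<close> assms(2) assms(3), of y] assms(4) by auto
  show "y \<in> nbrs E w" if "y \<in> {u, x}"
    using that assms(3) \<open>{w, u} \<in> E\<close> by auto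
qed

lemma rest_edges_disjoint:
  assumes "e \<in> rest_edges" "f \<in> rest_edges" "e \<inter> f \<noteq> {}" shows "e = f"
proof -
  obtain w where w: "w \<in> e" "w \<in> f" using assms(3) by blast
  have ef: "e \<in> E" "f \<in> E" "u \<notin> e" "u \<notin> f" "w \<notin> B" using assms w by (auto simp: rest_edges_def)
  obtain x y where "e = {w, x}" "f = {w, y}"
    using edge_other[OF ef(1) w(1)] edge_other[OF ef(2) w(2)] by blast
  then show ?thesis using ef rest_matching[of w x y] by auto
qed

lemma finite_rest_edges [simp]: "finite rest_edges" "finite tri_edges"
  by (auto simp: rest_edges_def tri_edges_def)

lemma finite_parts [simp]: "finite pends" "finite mids"
  by (rule finite_subset[OF _ finite_nbrs[of u]], force simp: pends_def mids_def)+

lemma Union_tri_edges: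
  "\<Union>tri_edges = {w \<in> nbrs E u - B. \<exists>x. {w, x} \<in> E \<and> {u, x} \<in> E}" (is "_ = ?T")
proof (intro Set.set_eqI iffI)
  fix w assume "w \<in> \<Union>tri_edges"
  then obtain e where e: "e \<in> E" "w \<in> e" "u \<notin> e" "e \<inter> B = {}" "e \<subseteq> nbrs E u"
    by (auto simp: tri_edges_def rest_edges_def)
  obtain x where "e = {w, x}" using edge_other e by blast
  then show "w \<in> ?T" using e by auto
next
  fix w assume "w \<in> ?T"
  then obtain x where x: "{u, w} \<in> E" "w \<notin> B" "{w, x} \<in> E" "{u, x} \<in> E" by auto
  then have "w \<noteq> u" "x \<noteq> u" by auto
  then have "{w, x} \<in> tri_edges"
    using x B_closed'[of w x] by (auto simp: tri_edges_def rest_edges_def)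
  then show "w \<in> \<Union>tri_edges" by blast
qed

lemma card_Union_tri_edges: "card (\<Union>tri_edges) = 2 * card tri_edges"
proof -
  have "card (\<Union>tri_edges) = sum card tri_edges"
    using rest_edges_disjoint
    by (intro card_Union_disjoint) (auto simp: pairwise_def disjnt_def tri_edges_def rest_edges_def dest: finite_subset)
  also have "\<dots> = sum (\<lambda>_. 2) tri_edges"
    by (rule sum.cong) (auto simp: tri_edges_def rest_edges_def elim!: edgeE)
  finally show ?thesis by simp
qed

text \<open>By \<open>rest_matching\<close> a neighbour of u outside B has at most one neighbour
  besides u. The three types correspond to this further neighbour being absent, not adjacent to u,
  or adjacent to u.\<close>

lemma nbrs_split:
  "nbrs E u - B = pends \<union> mids \<union> \<Union>tri_edges"
  "pends \<inter> mids = {}" "(pends \<union> mids) \<inter> \<Union>tri_edges = {}"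
proof -
  show "nbrs E u - B = pends \<union> mids \<union> \<Union>tri_edges"
  proof (intro Set.set_eqI iffI)
    fix w assume w: "w \<in> nbrs E u - B"
    show "w \<in> pends \<union> mids \<union> \<Union>tri_edges"
    proof (cases "nbrs E w \<subseteq> {u}")
      case True
      then have "nbrs E w = {u}" using w by (auto simp: insert_commute)
      then show ?thesis using w by (auto simp: pends_def)
    next
      case False
      then obtain x where "x \<noteq> u" "{w, x} \<in> E" unfolding nbrs_def by blast
      then show ?thesis unfolding Union_tri_edges mids_def using w by blast
    qed
  qed (auto simp: pends_def mids_def Union_tri_edges)
  show "pends \<inter> mids = {}" by (auto simp: pends_def mids_def nbrs_def)
  show "(pends \<union> mids) \<inter> \<Union>tri_edges = {}"
  proof -
    have "x = y" if "w \<notin> B" "{u, w} \<in> E" "{w, x} \<in> E" "{w, y} \<in> E" "x \<noteq> u" "{u, y} \<in> E" for w x y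
    proof -
      have "w \<noteq> u" "y \<noteq> u" using that by auto
      then show ?thesis using rest_matching[of w x y] that by blast
    qed
    moreover have "x = u" if "nbrs E w = {u}" "{w, x} \<in> E" for w x using that by (auto simp: nbrs_def)
    ultimately show ?thesis unfolding Union_tri_edges pends_def mids_def by fastforce
  qed
qed

lemma sum_nbrs_hub:
  fixes x :: "'a \<Rightarrow> 'b::comm_monoid_add"
  shows "sum x (nbrs E u) = sum x (nbrs E u \<inter> B) + (sum x pends + sum x mids + sum x (\<Union>tri_edges))"
proof -
  have fin: "finite (\<Union>tri_edges)" by (rule finite_subset[OF _ finite_nbrs[of u]]) (auto simp: tri_edges_def)
  have "sum x (nbrs E u) = sum x (nbrs E u \<inter> B) + sum x (nbrs E u - B)"
    by (rule sum.Int_Diff) simp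
  also have "sum x (nbrs E u - B) = sum x pends + sum x mids + sum x (\<Union>tri_edges)"
    unfolding nbrs_split(1) using nbrs_split(2,3) fin by (simp add: sum.union_disjoint)
  finally show ?thesis .
qed

lemma card_nbrs_hub:
  "card (nbrs E u) = card (nbrs E u \<inter> B) + (card pends + card mids + 2 * card tri_edges)"
  using sum_nbrs_hub[of "\<lambda>_. 1::nat"] card_Union_tri_edges by simp

text \<open>Joining the middle of each path to its partner injects \<open>mids\<close> into the
  remaining edges off the triangles, because the partner is not adjacent to u. This is how the
  matching number limits b + c.\<close>

lemma card_mids_tri_edges: "card mids + card tri_edges \<le> card rest_edges"
proof -
  let ?f = "\<lambda>w. {w, partner w}"
  have p: "{w, partner w} \<in> E \<and> partner w \<noteq> u \<and> {u, partner w} \<notin> E \<and> {u, w} \<in> E \<and> w \<noteq> u \<and> w \<notin> B"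
    if "w \<in> mids" for w
  proof -
    obtain x where x: "{u, w} \<in> E" "w \<notin> B" "x \<noteq> u" "{w, x} \<in> E" "{u, x} \<notin> E"
      using \<open>w \<in> mids\<close> by (auto simp: mids_def)
    then have "w \<noteq> u" by auto
    then show ?thesis using x partner_eq[of w x] by auto
  qed
  have "inj_on ?f mids"
    using p by (auto simp: inj_on_def doubleton_eq_iff)
  moreover have "?f ` mids \<subseteq> rest_edges - tri_edges"
  proof
    fix e assume "e \<in> ?f ` mids"
    then obtain w where w: "w \<in> mids" "e = {w, partner w}" by auto
    then show "e \<in> rest_edges - tri_edges"
      using p[OF w(1)] B_closed'[of w "partner w"] by (auto simp: rest_edges_def tri_edges_def)
  qed
  ultimately have "card mids \<le> card (rest_edges - tri_edges)"
    using card_mono[of "rest_edges - tri_edges" "?f ` mids"] by (simp add: card_image)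
  also have "\<dots> = card rest_edges - card tri_edges"
    by (rule card_Diff_subset) (auto simp: tri_edges_def)
  finally have "card mids \<le> card rest_edges - card tri_edges" .
  moreover have "card tri_edges \<le> card rest_edges"
    by (rule card_mono) (auto simp: tri_edges_def)
  ultimately show ?thesis by simp
qed

text \<open>With entry 1 at u, the weights of S_{a,b,c} satisfy the eigenvalue equation with
  equality at the vertices outside B that are connected to u. Hence a deficit at u settles its whole
  component, while components that are single vertices or edges have a deficit of their own because
  r > 2. The caller provides the entries on B; the summand depending on
  \<open>{u, w} \<in> E\<close> is the entry at u.\<close>

lemma eigenvalue_less_hub:
  assumes r: "r > 3"
    and yB_pos: "\<And>w. w \<in> B \<Longrightarrow> yB w > 0"
    and yB_sup: "\<And>w. w \<in> B \<Longrightarrow> real (card (nbrs E w)) * yB w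
        + ((if {u, w} \<in> E then 1 else 0) + sum yB (nbrs E w - {u})) \<le> r * yB w"
    and reach: "\<And>w. w \<in> B \<Longrightarrow> (\<lambda>s t. {s, t} \<in> E)\<^sup>*\<^sup>* w u"
    and centre: "real (card (nbrs E u)) + sum yB (nbrs E u \<inter> B)
        + S_sum (card pends) (card mids) (card tri_edges) r < r"
    and mu: "Q_eigenvalue V E mu"
  shows "mu < r"
proof -
  \<comment> \<open>The final value 1 is for the isolated vertices and edges away from u.\<close>
  define y where "y w = (if w = u then 1 else if w \<in> B then yB w else
      if w \<in> pends then pend_wt r else if w \<in> mids then path_wt r else
      if w \<in> \<Union>tri_edges then tri_wt r else
      if \<exists>x\<in>mids. {w, x} \<in> E then end_wt r else 1)" for w
  let ?L = "\<lambda>w. real (card (nbrs E w)) * y w + sum y (nbrs E w)"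
  have y_u: "y u = 1" by (simp add: y_def)
  have y_B: "y w = yB w" if "w \<in> B" for w using that u_notin_B by (auto simp: y_def)
  have classes: "w \<noteq> u \<and> w \<notin> B \<and> {u, w} \<in> E" if "w \<in> pends \<union> mids \<union> \<Union>tri_edges" for w
  proof -
    have "w \<in> nbrs E u - B" using that nbrs_split(1) by blast
    then show ?thesis by auto
  qed
  have y_pend: "y w = pend_wt r" if "w \<in> pends" for w using that classes[of w] by (simp add: y_def)
  have y_mid: "y w = path_wt r" if "w \<in> mids" for w
    using that classes[of w] nbrs_split(2) by (auto simp: y_def)
  have y_tri: "y w = tri_wt r" if "w \<in> \<Union>tri_edges" for w
  proof -
    have "w \<notin> pends" "w \<notin> mids" using that nbrs_split(3) by blast+
    then show ?thesis using that classes[of w] by (simp add: y_def)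
  qed
  have y_end: "y w = end_wt r" if "w \<noteq> u" "w \<notin> B" "{u, w} \<notin> E" "x \<in> mids" "{w, x} \<in> E" for w x
    using that classes[of w] by (auto simp: y_def)
  have y_one: "y w = 1" if "w \<noteq> u" "w \<notin> B" "{u, w} \<notin> E" "\<not> (\<exists>x\<in>mids. {w, x} \<in> E)" for w
    using that classes[of w] by (auto simp: y_def)
  have one: "(\<lambda>s t. {s, t} \<in> E)\<^sup>*\<^sup>* w u" if "{u, w} \<in> E" for w
    using that by (intro r_into_rtranclp) (simp add: insert_commute)
  have main: "?L w \<le> r * y w \<and> ((\<lambda>s t. {s, t} \<in> E)\<^sup>*\<^sup>* w u \<or> ?L w < r * y w)"
    if w: "w \<noteq> u" "w \<notin> B" for w
  proof (cases "{u, w} \<in> E")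
    case True
    then have "w \<in> nbrs E u - B" using w by simp
    then consider "w \<in> pends" | "w \<in> mids" | "w \<in> \<Union>tri_edges" using nbrs_split(1) by blast
    then have "?L w = r * y w"
    proof cases
      case 1
      then have "nbrs E w = {u}" by (simp add: pends_def)
      then show ?thesis using y_pend[OF 1] y_u wt_eqs(1)[of r] r by simp
    next
      case 2
      then obtain x where x: "x \<noteq> u" "{w, x} \<in> E" "{u, x} \<notin> E" by (auto simp: mids_def)
      have "nbrs E w = {u, x}" using x True w by (intro nbrs_eq_pair)
      moreover have "y x = end_wt r"
        using x 2 B_closed'[of w x] w by (intro y_end[of x w]) (auto simp: insert_commute)
      ultimately show ?thesis using y_mid[OF 2] y_u wt_eqs(2)[of r] r x by simp
    next
      case 3
      then obtain x where x: "{w, x} \<in> E" "{u, x} \<in> E" by (auto simp: Union_tri_edges)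
      then have xu: "x \<noteq> u" by auto
      have "nbrs E w = {u, x}" using x True w xu by (intro nbrs_eq_pair)
      moreover have "x \<in> \<Union>tri_edges"
        unfolding Union_tri_edges using x True w B_closed'[of w x] by (auto simp: insert_commute)
      ultimately show ?thesis using y_tri[OF 3] y_tri[of x] y_u wt_eqs(4)[of r] r xu by simp
    qed
    then show ?thesis using one[OF True] by simp
  next
    case False
    show ?thesis
    proof (cases "nbrs E w = {}")
      case True
      then have "\<not> (\<exists>x\<in>mids. {w, x} \<in> E)" by (auto simp: nbrs_def)
      then show ?thesis using y_one[of w] w False True r by simp
    next
      case nonempty: False
      then obtain x where x: "{w, x} \<in> E" by (auto simp: nbrs_def)
      then have xu: "x \<noteq> u" using False by (auto simp: insert_commute)
      have xB: "x \<notin> B" using B_closed' x w by blast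
      have nb: "nbrs E w = {x}"
      proof -
        have "t = x" if "{w, t} \<in> E" for t
        proof -
          have "t \<noteq> u" using that False by (auto simp: insert_commute)
          then show ?thesis using rest_matching[OF w that x] xu by simp
        qed
        then show ?thesis using x unfolding nbrs_def by blast
      qed
      show ?thesis
      proof (cases "{u, x} \<in> E")
        case True
        then have "x \<in> mids" using x xB w False by (auto simp: mids_def insert_commute)
        then have "?L w = r * y w"
          using y_end[of w x] y_mid[of x] w False x nb wt_eqs(3)[of r] r by simp
        moreover have "(\<lambda>s t. {s, t} \<in> E)\<^sup>*\<^sup>* w u"
          using converse_rtranclp_into_rtranclp[of _ w x u] x one[OF True] by simp
        ultimately show ?thesis by simp
      next
        case xn: False
        have "t = w" if "{x, t} \<in> E" for t
        proof -
          have "t \<noteq> u" using that xn by (auto simp: insert_commute)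
          then show ?thesis using rest_matching[OF xu xB that] x w by (simp add: insert_commute)
        qed
        then have "\<not> (\<exists>t\<in>mids. {x, t} \<in> E)" using classes False by blast
        then have "y x = 1" using y_one xu xB xn by blast
        moreover have "\<not> (\<exists>t\<in>mids. {w, t} \<in> E)"
        proof
          assume "\<exists>t\<in>mids. {w, t} \<in> E"
          then obtain t where t: "t \<in> mids" "t \<in> nbrs E w" by auto
          then have "t = x" using nb by blast
          then show False using t classes xn by blast
        qed
        then have "y w = 1" using y_one w False by blast
        ultimately show ?thesis using nb r by simp
      qed
    qed
  qed
  have L_B: "?L w \<le> r * y w" if "w \<in> B" for w
  proof -
    have "sum y (nbrs E w - {u}) = sum yB (nbrs E w - {u})"
      using B_closed[OF that] y_B by (intro sum.cong) auto
    moreover have "sum y (nbrs E w) = (if {u, w} \<in> E then 1 else 0) + sum y (nbrs E w - {u})"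
      using y_u by (cases "{u, w} \<in> E") (simp_all add: sum.remove[of _ u] insert_commute)
    ultimately show ?thesis using yB_sup[OF that] y_B[OF that] by simp
  qed
  have L_u: "?L u < r * y u"
  proof -
    have "sum y (\<Union>tri_edges) = 2 * card tri_edges * tri_wt r"
      using y_tri card_Union_tri_edges by simp
    moreover have "sum y (nbrs E u \<inter> B) = sum yB (nbrs E u \<inter> B)" using y_B by (intro sum.cong) auto
    ultimately show ?thesis
      unfolding sum_nbrs_hub using centre y_u y_pend y_mid by (simp add: S_sum_def)
  qed
  have "y w > 0" for w
    using wt_pos[of r] r yB_pos by (auto simp: y_def)
  moreover have "?L w \<le> r * y w" for w
    using main L_B L_u by (cases "w = u"; cases "w \<in> B") auto
  moreover have "\<exists>w'. (\<lambda>s t. {s, t} \<in> E)\<^sup>*\<^sup>* w w' \<and> ?L w' < r * y w'" for w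
    using main[of w] L_u reach[of w] by (cases "w = u"; cases "w \<in> B") blast+
  ultimately show ?thesis using eigenvalue_bound(2)[of y r mu] mu by blast
qed

text \<open>If B is empty, an edge avoiding u is the outer edge of a path, the far side of a
  triangle, or an isolated edge, since the edges avoiding u are pairwise disjoint. Enumerating each
  kind gives the isomorphism.\<close>

lemma graph_iso_S_ext:
  assumes B: "B = {}"
  shows "\<exists>k l. graph_iso V E (S_ext_V (card pends) (card mids) (card tri_edges) k l)
    (S_ext_E (card pends) (card mids) (card tri_edges) k l)"
proof -
  define iso_edges where "iso_edges = {e \<in> rest_edges. e \<inter> nbrs E u = {}}"
  define isolated where "isolated = {w \<in> V - {u}. nbrs E w = {}}"
  define a b c k l where "a = card pends" "b = card mids" "c = card tri_edges"
    "k = card iso_edges" "l = card isolated"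
  have fin: "finite iso_edges" "finite isolated" by (auto simp: iso_edges_def isolated_def)
  obtain p where p: "bij_betw p {..<a} pends"
    using ex_bij_betw_nat_finite[of pends] by (auto simp: atLeast0LessThan a_b_c_k_l_def)
  obtain q where q: "bij_betw q {..<b} mids"
    using ex_bij_betw_nat_finite[of mids] by (auto simp: atLeast0LessThan a_b_c_k_l_def)
  obtain z where z: "bij_betw z {..<l} isolated"
    using ex_bij_betw_nat_finite[of isolated] fin by (auto simp: atLeast0LessThan a_b_c_k_l_def)
  have pair: "\<exists>x y. x \<noteq> y \<and> e = {x, y}" if "e \<in> rest_edges" for e
    using that by (auto simp: rest_edges_def elim!: edgeE)
  obtain s t where st: "tri_edges = (\<lambda>i. {s i, t i}) ` {..<c}"
    "\<And>i. i < c \<Longrightarrow> s i \<noteq> t i"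
    "\<And>i j. i < c \<Longrightarrow> j < c \<Longrightarrow> {s i, t i} \<inter> {s j, t j} \<noteq> {} \<Longrightarrow> i = j"
    by (rule disjoint_edges_enumeration[of tri_edges])
      (auto simp: tri_edges_def a_b_c_k_l_def pair rest_edges_disjoint)
  obtain v w where vw: "iso_edges = (\<lambda>i. {v i, w i}) ` {..<k}"
    "\<And>i. i < k \<Longrightarrow> v i \<noteq> w i"
    "\<And>i j. i < k \<Longrightarrow> j < k \<Longrightarrow> {v i, w i} \<inter> {v j, w j} \<noteq> {} \<Longrightarrow> i = j"
    by (rule disjoint_edges_enumeration[of iso_edges])
      (auto simp: iso_edges_def a_b_c_k_l_def pair rest_edges_disjoint)
  define g where "g x = (case x of Center \<Rightarrow> u | Pend i \<Rightarrow> p i | PMid i \<Rightarrow> q i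
    | PEnd i \<Rightarrow> partner (q i) | TriA i \<Rightarrow> s i | TriB i \<Rightarrow> t i | IsoE1 i \<Rightarrow> v i | IsoE2 i \<Rightarrow> w i
    | IsoV i \<Rightarrow> z i)" for x
  let ?V = "S_ext_V a b c k l" and ?E = "S_ext_E a b c k l"
  have mid: "{x, partner x} \<in> E \<and> partner x \<noteq> u \<and> {u, partner x} \<notin> E \<and> {u, x} \<in> E \<and> x \<noteq> u"
    if m: "x \<in> mids" for x
  proof -
    obtain y where y: "{u, x} \<in> E" "y \<noteq> u" "{x, y} \<in> E" "{u, y} \<notin> E"
      using m by (auto simp: mids_def)
    then have "x \<noteq> u" by auto
    then show ?thesis using y partner_eq[of x y] B by auto
  qed
  have partner_inj: "x = y" if "x \<in> mids" "y \<in> mids" "partner x = partner y" for x y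
    using rest_matching[of "partner x" x y] mid[OF that(1)] mid[OF that(2)] that(3) B
    by (auto simp: insert_commute)
  have p_mem: "p i \<in> pends" if "i < a" for i using p that by (auto simp: bij_betw_def)
  have q_mem: "q i \<in> mids" if "i < b" for i using q that by (auto simp: bij_betw_def)
  have z_mem: "z i \<in> isolated" if "i < l" for i using z that by (auto simp: bij_betw_def)
  have st_mem: "s i \<in> \<Union>tri_edges" "t i \<in> \<Union>tri_edges" "{s i, t i} \<in> E" if "i < c" for i
  proof -
    have "{s i, t i} \<in> tri_edges" using st(1) that by blast
    then show "s i \<in> \<Union>tri_edges" "t i \<in> \<Union>tri_edges" "{s i, t i} \<in> E"
      by (blast, blast, simp add: tri_edges_def rest_edges_def)
  qed
  have vw_mem: "v i \<in> \<Union>iso_edges" "w i \<in> \<Union>iso_edges" "{v i, w i} \<in> E" if "i < k" for i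
  proof -
    have "{v i, w i} \<in> iso_edges" using vw(1) that by blast
    then show "v i \<in> \<Union>iso_edges" "w i \<in> \<Union>iso_edges" "{v i, w i} \<in> E"
      by (blast, blast, simp add: iso_edges_def rest_edges_def)
  qed
  have N: "x \<noteq> u \<and> {u, x} \<in> E" if "x \<in> pends \<union> mids \<union> \<Union>tri_edges" for x
  proof -
    have "x \<in> nbrs E u" using that nbrs_split(1) by blast
    then show ?thesis by auto
  qed
  \<comment> \<open>The type of a vertex as seen in G, to be matched with \<open>code\<close>, the
    type of its name. Equality of images then forces equality of types, and injectivity is checked
    type by type. The two ends of a triangle side or of an isolated edge share a type because their
    order is arbitrary; 3 remains for the ends of pendant paths.\<close>
  define cl :: "'a \<Rightarrow> nat" where "cl x = (if x = u then 0 else if x \<in> pends then 1 else if x \<in> mids then 2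
    else if x \<in> \<Union>tri_edges then 4 else if nbrs E x = {} then 6
    else if x \<in> \<Union>iso_edges then 5 else 3)" for x
  define code :: "svert \<Rightarrow> nat" where "code x = (case x of Center \<Rightarrow> 0 | Pend i \<Rightarrow> 1 | PMid i \<Rightarrow> 2
    | PEnd i \<Rightarrow> 3 | TriA i \<Rightarrow> 4 | TriB i \<Rightarrow> 4 | IsoE1 i \<Rightarrow> 5 | IsoE2 i \<Rightarrow> 5 | IsoV i \<Rightarrow> 6)" for x
  have iso: "x \<noteq> u \<and> {u, x} \<notin> E \<and> nbrs E x \<noteq> {} \<and> x \<in> V" if m: "x \<in> \<Union>iso_edges" for x
  proof -
    obtain e where e: "e \<in> E" "u \<notin> e" "e \<inter> nbrs E u = {}" "x \<in> e"
      using m by (auto simp: iso_edges_def rest_edges_def)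
    obtain y where "e = {x, y}" using edge_other e by blast
    then show ?thesis using e edge_in_V[of x y] by (auto simp: nbrs_def)
  qed
  have iso2: "y \<in> \<Union>iso_edges" if m: "x \<in> \<Union>iso_edges" "{x, y} \<in> E" for x y
  proof -
    obtain e where e: "e \<in> E" "u \<notin> e" "e \<inter> nbrs E u = {}" "x \<in> e" "e \<in> iso_edges"
      using m by (auto simp: iso_edges_def rest_edges_def)
    obtain y' where y': "e = {x, y'}" using edge_other e by blast
    have "x \<noteq> u" "y' \<noteq> u" "{u, x} \<notin> E" using e y' by auto
    moreover have "y \<noteq> u" using m \<open>{u, x} \<notin> E\<close> by (auto simp: insert_commute)
    ultimately have "y = y'" using rest_matching[of x y y'] m e y' B by auto
    then show ?thesis using e y' by auto
  qed
  have cl_N: "cl x = 1" if "x \<in> pends" for x using that N[of x] by (simp add: cl_def)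
  have cl_M: "cl x = 2" if "x \<in> mids" for x
    using that N[of x] nbrs_split(2) by (auto simp: cl_def)
  have cl_T: "cl x = 4" if "x \<in> \<Union>tri_edges" for x
  proof -
    have "x \<notin> pends" "x \<notin> mids" using that nbrs_split(3) by blast+
    then show ?thesis using that N[of x] by (simp add: cl_def)
  qed
  have cl_E: "cl (partner x) = 3" if "x \<in> mids" for x
  proof -
    have "partner x \<notin> pends \<union> mids \<union> \<Union>tri_edges" using N mid[OF that] by blast
    moreover have "partner x \<notin> \<Union>iso_edges"
      using iso2[of "partner x" x] iso[of x] mid[OF that] by (auto simp: insert_commute)
    moreover have "nbrs E (partner x) \<noteq> {}" using mid[OF that] by (auto simp: nbrs_def insert_commute)
    ultimately show ?thesis using mid[OF that] by (simp add: cl_def)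
  qed
  have cl_I: "cl x = 5" if "x \<in> \<Union>iso_edges" for x
  proof -
    have "x \<notin> pends \<union> mids \<union> \<Union>tri_edges" using N iso[OF that] by blast
    then show ?thesis using iso[OF that] that by (simp add: cl_def)
  qed
  have cl_L: "cl x = 6" if "x \<in> isolated" for x
  proof -
    have x: "x \<noteq> u" "nbrs E x = {}" using that by (auto simp: isolated_def)
    then have "{u, x} \<notin> E" by (auto simp: nbrs_def insert_commute)
    then have "x \<notin> pends \<union> mids \<union> \<Union>tri_edges" using N by blast
    then show ?thesis using x by (simp add: cl_def)
  qed
  have cl_g: "cl (g x) = code x" if "x \<in> ?V" for x
    using that p_mem q_mem z_mem st_mem(1,2) vw_mem(1,2) cl_N cl_M cl_E cl_T cl_I cl_L
    by (cases x) (auto simp: S_ext_V_def g_def code_def cl_def[of u])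
  have inj: "p i = p j \<longleftrightarrow> i = j" if "i < a" "j < a" for i j
    using p that by (auto simp: bij_betw_def inj_on_def)
  have inj_q: "q i = q j \<longleftrightarrow> i = j" if "i < b" "j < b" for i j
    using q that by (auto simp: bij_betw_def inj_on_def)
  have inj_z: "z i = z j \<longleftrightarrow> i = j" if "i < l" "j < l" for i j
    using z that by (auto simp: bij_betw_def inj_on_def)
  have inj_e: "partner (q i) = partner (q j) \<longleftrightarrow> i = j" if "i < b" "j < b" for i j
    using partner_inj[OF q_mem q_mem] inj_q that by blast
  have inj_st: "s i = s j \<longleftrightarrow> i = j" "t i = t j \<longleftrightarrow> i = j" "s i \<noteq> t j" "t i \<noteq> s j"
    if "i < c" "j < c" for i j
    using st(3)[OF that] st(2)[OF that(1)] by auto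
  have inj_vw: "v i = v j \<longleftrightarrow> i = j" "w i = w j \<longleftrightarrow> i = j" "v i \<noteq> w j" "w i \<noteq> v j"
    if "i < k" "j < k" for i j
    using vw(3)[OF that] vw(2)[OF that(1)] by auto
  have "inj_on g ?V"
  proof (rule inj_onI)
    fix x y assume xy: "x \<in> ?V" "y \<in> ?V" "g x = g y"
    then have "code x = code y" using cl_g by metis
    then show "x = y"
      using xy by (cases x; cases y; simp add: code_def S_ext_V_def g_def image_iff;
        simp add: inj inj_q inj_z inj_e inj_st inj_vw)
  qed
  moreover have gV: "V = g ` ?V"
  proof
    show "g ` ?V \<subseteq> V"
    proof
      fix x assume "x \<in> g ` ?V"
      then obtain y where y: "y \<in> ?V" "x = g y" by auto
      have "\<Union>tri_edges \<subseteq> V" "pends \<subseteq> V" "mids \<subseteq> V" "isolated \<subseteq> V"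
        using N edge_in_V by (blast, blast, blast, simp add: isolated_def)
      moreover have "partner x \<in> V" if "x \<in> mids" for x using mid[OF that] edge_in_V by blast
      ultimately show "x \<in> V"
        using y p_mem q_mem z_mem st_mem(1,2) vw_mem(1,2) iso u_in_V
        by (cases y) (auto simp: S_ext_V_def g_def)
    qed
    show "V \<subseteq> g ` ?V"
    proof
      fix x assume x: "x \<in> V"
      have gI: "x \<in> g ` ?V" if "y \<in> ?V" "x = g y" for y using that by blast
      consider "x = u" | "x \<in> pends" | "x \<in> mids" | "x \<in> \<Union>tri_edges" | "x \<noteq> u" "{u, x} \<notin> E"
      proof (cases "x \<in> nbrs E u")
        case True
        then have "x \<in> pends \<union> mids \<union> \<Union>tri_edges" using nbrs_split(1) B by blast
        then show thesis using that by blast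
      qed (use that in auto)
      then show "x \<in> g ` ?V"
      proof cases
        case 1 then show ?thesis by (intro gI[of Center]) (simp_all add: g_def S_ext_V_def)
      next
        case 2
        then obtain i where "i < a" "x = p i" using p by (auto simp: bij_betw_def)
        then show ?thesis by (intro gI[of "Pend i"]) (simp_all add: g_def S_ext_V_def)
      next
        case 3
        then obtain i where "i < b" "x = q i" using q by (auto simp: bij_betw_def)
        then show ?thesis by (intro gI[of "PMid i"]) (simp_all add: g_def S_ext_V_def)
      next
        case 4
        then obtain i where "i < c" "x = s i \<or> x = t i" unfolding st(1) by auto
        then show ?thesis
          using gI[of "TriA i"] gI[of "TriB i"] by (auto simp: g_def S_ext_V_def)
      next
        case 5
        show ?thesis
        proof (cases "nbrs E x = {}")
          case True
          then have "x \<in> isolated" using 5 x by (simp add: isolated_def)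
          then obtain i where "i < l" "x = z i" using z by (auto simp: bij_betw_def)
          then show ?thesis by (intro gI[of "IsoV i"]) (simp_all add: g_def S_ext_V_def)
        next
          case False
          then obtain y where y: "{x, y} \<in> E" by (auto simp: nbrs_def)
          then have yx: "{y, x} \<in> E" by (simp add: insert_commute)
          have yu: "y \<noteq> u" using 5 yx by auto
          show ?thesis
          proof (cases "{u, y} \<in> E")
            case True
            then have "y \<in> mids" unfolding mids_def using 5 yx B by auto
            moreover have "partner y = x" using partner_eq[of y x] yu 5 yx B by simp
            moreover obtain i where "i < b" "y = q i" using calculation(1) q by (auto simp: bij_betw_def)
            ultimately show ?thesis by (intro gI[of "PEnd i"]) (simp_all add: g_def S_ext_V_def)
          next
            case False
            then have "{x, y} \<in> iso_edges" unfolding iso_edges_def rest_edges_def using y yu 5 B by auto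
            then obtain i where "i < k" "{x, y} = {v i, w i}" unfolding vw(1) by auto
            then have "i < k" "x = v i \<or> x = w i" by auto
            then show ?thesis
              using gI[of "IsoE1 i"] gI[of "IsoE2 i"] by (auto simp: g_def S_ext_V_def)
          qed
        qed
      qed
    qed
  qed
  moreover have "E = (`) g ` ?E"
  proof -
    have im: "(`) g ` ?E = (\<lambda>i. {u, p i}) ` {..<a} \<union> (\<lambda>i. {u, q i}) ` {..<b}
      \<union> (\<lambda>i. {q i, partner (q i)}) ` {..<b} \<union> (\<lambda>i. {u, s i}) ` {..<c} \<union> (\<lambda>i. {u, t i}) ` {..<c}
      \<union> (\<lambda>i. {s i, t i}) ` {..<c} \<union> (\<lambda>i. {v i, w i}) ` {..<k}"
      by (simp add: S_ext_E_def image_Un image_image g_def)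
    have imp: "p ` {..<a} = pends" "q ` {..<b} = mids" using p q by (auto simp: bij_betw_def)
    have imt: "s ` {..<c} \<union> t ` {..<c} = \<Union>tri_edges" unfolding st(1) by auto
    have "(`) g ` ?E = (\<lambda>x. {u, x}) ` (p ` {..<a} \<union> q ` {..<b} \<union> (s ` {..<c} \<union> t ` {..<c}))
      \<union> (\<lambda>x. {x, partner x}) ` (q ` {..<b}) \<union> tri_edges \<union> iso_edges"
      unfolding im image_Un image_image st(1)[symmetric] vw(1)[symmetric] by (simp only: Un_ac)
    also have "\<dots> = (\<lambda>x. {u, x}) ` nbrs E u \<union> (\<lambda>x. {x, partner x}) ` mids \<union> tri_edges \<union> iso_edges"
      unfolding imp imt using nbrs_split(1) B by simp
    also have "\<dots> = E"
    proof
      show "(\<lambda>x. {u, x}) ` nbrs E u \<union> (\<lambda>x. {x, partner x}) ` mids \<union> tri_edges \<union> iso_edges \<subseteq> E"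
        using mid by (auto simp: tri_edges_def iso_edges_def rest_edges_def)
      show "E \<subseteq> (\<lambda>x. {u, x}) ` nbrs E u \<union> (\<lambda>x. {x, partner x}) ` mids \<union> tri_edges \<union> iso_edges"
      proof
        fix e assume e: "e \<in> E"
        show "e \<in> (\<lambda>x. {u, x}) ` nbrs E u \<union> (\<lambda>x. {x, partner x}) ` mids \<union> tri_edges \<union> iso_edges"
        proof (cases "u \<in> e")
          case True
          then show ?thesis using edges_at[of u] e by blast
        next
          case False
          then have er: "e \<in> rest_edges" unfolding rest_edges_def using e B by simp
          show ?thesis
          \<comment> \<open>An edge avoiding u with exactly one end adjacent to u is the outer edge
            of a pendant path.\<close>
          proof (cases "e \<subseteq> nbrs E u \<or> e \<inter> nbrs E u = {}")
            case True
            then show ?thesis using er by (auto simp: tri_edges_def iso_edges_def)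
          next
            case nc: False
            then obtain x where x: "x \<in> e" "{u, x} \<in> E" by auto
            obtain y where y: "e = {x, y}" using edge_other[OF e x(1)] by blast
            have "y \<noteq> u" "x \<noteq> u" using False y by auto
            moreover have "{u, y} \<notin> E" using nc x y by auto
            ultimately have "x \<in> mids" "partner x = y"
              unfolding mids_def using partner_eq[of x y] x e y B by auto
            then show ?thesis using y by blast
          qed
        qed
      qed
    qed
    finally show ?thesis by simp
  qed
  moreover have "?E \<subseteq> Pow ?V" using simple_graph_S_ext[of a b c k l] by (fastforce simp: simple_graph_def)
  ultimately have "graph_iso V E ?V ?E" by (rule graph_isoI)
  then show ?thesis unfolding a_b_c_k_l_def by blast
qed

end

section \<open>Edges of maximal degree sum\<close>

lemma S_sum_Suc: "S_sum (a + n) b (Suc c) r = S_sum a b c r + n * pend_wt r + 2 * tri_wt r"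
  by (simp add: S_sum_def algebra_simps)

text \<open>With \<open>a + b + 2c\<close> fixed, exchanging pendant edges for paths and both for triangles
  increases \<open>S_sum\<close>; the number of available exchanges is limited by \<open>b + c\<close>.\<close>

lemma S_sum_extremal:
  fixes t \<beta> :: nat
  assumes r: "r > 3" and \<beta>: "\<beta> \<ge> 2"
    and abc': "a' \<ge> 1" "a' + b' + 2 * c' = t + 1" "b' + c' + 1 \<le> \<beta>"
    and abc: "a + b + 2 * c = t + 1"
      "2 * \<beta> - 1 \<le> t \<and> b = 0 \<and> c = \<beta> - 1 \<or> t < 2 * \<beta> - 1 \<and> b = t mod 2 \<and> c = t div 2"
  shows "(a', b', c') = (a, b, c) \<or> S_sum a' b' c' r < S_sum a b c r"
proof -
  \<comment> \<open>The gains over a pendant vertex, per neighbour of the centre. As the number of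
    these neighbours is fixed, only b * g2 + 2 * c * g3 has to be compared.\<close>
  define g2 g3 where "g2 = path_wt r - pend_wt r" and "g3 = tri_wt r - pend_wt r"
  have g: "0 < g2" "g2 < g3" using wt_mono[OF r] by (auto simp: g2_def g3_def)
  have S: "S_sum x y z r = (t + 1) * pend_wt r + (y * g2 + 2 * z * g3)" if "x + y + 2 * z = t + 1" for x y z
  proof -
    have x: "real x = real t + 1 - real y - 2 * real z" using that by linarith
    show ?thesis unfolding S_sum_def g2_def g3_def x by (simp add: algebra_simps)
  qed
  \<comment> \<open>If c = \<beta> - 1 this is the matching constraint; if c = t div 2 it is parity
    together with a' \<ge> 1.\<close>
  have "c' \<le> c" using abc abc' by auto
  have "(b', c') = (b, c) \<or> b' * g2 + 2 * c' * g3 < b * g2 + 2 * c * g3"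
  proof (cases "c' = c")
    case True
    then have "b' \<le> b" using abc abc' mult_div_mod_eq[of 2 t] by linarith
    then show ?thesis using True g by (cases "b' = b") auto
  next
    case False
    then have c: "real c' + 1 \<le> c" using \<open>c' \<le> c\<close> by linarith
    from abc(2) show ?thesis
    proof
      assume A: "2 * \<beta> - 1 \<le> t \<and> b = 0 \<and> c = \<beta> - 1"
      \<comment> \<open>Giving up a triangle makes room for at most one path in the matching
        constraint, a gain of g2 against a loss of 2 * g3.\<close>
      then have "real b' + c' \<le> c" using abc'(3) by linarith
      then have "b' * g2 \<le> (real c - c') * g2" using g by (intro mult_right_mono) auto
      also have "\<dots> < (real c - c') * (2 * g3)" using g c by (intro mult_strict_left_mono) auto
      finally have "b' * g2 < (real c - c') * (2 * g3)" .
      moreover have "b = 0" using A by blast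
      ultimately show ?thesis by (simp add: algebra_simps)
    next
      assume A: "t < 2 * \<beta> - 1 \<and> b = t mod 2 \<and> c = t div 2"
      then have "b + 2 * c = t" by simp
      \<comment> \<open>Now the degree of the centre is the binding constraint: giving up a triangle
        makes room for up to two paths, still a loss because g2 < g3.\<close>
      then have "b' + 2 * c' \<le> b + 2 * c" using abc' by linarith
      then have "real (b' + 2 * c') \<le> real (b + 2 * c)" by (rule of_nat_mono)
      then have "real b' \<le> b + 2 * (real c - c')" by simp
      then have "b' * g2 \<le> (b + 2 * (real c - c')) * g2" using g by (intro mult_right_mono) auto
      moreover have "(real c - c') * g2 < (real c - c') * g3" using g c by (intro mult_strict_left_mono) auto
      ultimately show ?thesis by (simp add: algebra_simps)
    qed
  qed
  then show ?thesis using S[OF abc'(2)] S[OF abc(1)] abc(1) abc'(2) by auto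
qed

lemma card_filter_split:
  assumes "finite A" shows "card A = card {e \<in> A. P e} + card {e \<in> A. \<not> P e}"
proof -
  have "{e \<in> A. P e} \<union> {e \<in> A. \<not> P e} = A" by auto
  then show ?thesis using card_Un_disjoint[of "{e \<in> A. P e}" "{e \<in> A. \<not> P e}"] assms by auto
qed

section \<open>Matchings against degrees, and the degree vector as test vector\<close>

context sgraph
begin

lemma maximum_matching: obtains M where "is_matching E M" "card M = matching_number E"
proof -
  have "finite {M. is_matching E M}"
    by (rule finite_subset[of _ "Pow E"]) (auto simp: is_matching_def)
  moreover have "is_matching E {}" by (simp add: is_matching_def)
  ultimately have "matching_number E \<in> card ` {M. is_matching E M}"
    unfolding matching_number_def by (intro Max_in) auto
  then show thesis using that by auto
qed

lemma card_matching_at: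
  assumes "is_matching E M" shows "card {e \<in> M. u \<in> e} \<le> 1"
proof -
  have fin: "finite M" using assms finite_subset[OF _ finite_E] by (auto simp: is_matching_def)
  have "e = f" if "e \<in> M" "f \<in> M" "u \<in> e" "u \<in> f" for e f
    using assms that unfolding is_matching_def by blast
  then show ?thesis using fin by (auto simp: card_le_Suc0_iff_eq)
qed

lemma card_edges_at: "card {e \<in> E. u \<in> e} = card (nbrs E u)"
  using degree_nbrs[of u] by (simp add: Defs.degree_def)

text \<open>A maximum matching has at most one edge at u, so at least
  \<open>matching_number E - 1\<close> edges avoid u.\<close>

lemma degree_matching_bound: "card (nbrs E u) + matching_number E \<le> card E + 1"
proof -
  obtain M where M: "is_matching E M" "card M = matching_number E" by (rule maximum_matching)
  have ME: "M \<subseteq> E" using M by (simp add: is_matching_def)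
  have fin: "finite M" using finite_subset[OF ME] by simp
  have "card M = card {e \<in> M. u \<in> e} + card {e \<in> M. u \<notin> e}" by (rule card_filter_split[OF fin])
  also have "card {e \<in> M. u \<notin> e} \<le> card {e \<in> E. u \<notin> e}" using ME by (intro card_mono) auto
  finally have "card M \<le> 1 + card {e \<in> E. u \<notin> e}" using card_matching_at[OF M(1), of u] by simp
  moreover have "card E = card {e \<in> E. u \<in> e} + card {e \<in> E. u \<notin> e}"
    by (rule card_filter_split) simp
  ultimately show ?thesis using M(2) card_edges_at by simp
qed

lemma card_edges_at_edge:
  assumes "{u, v} \<in> E"
  shows "card E + 1 = card (nbrs E u) + card (nbrs E v) + card {e \<in> E. u \<notin> e \<and> v \<notin> e}"
proof -
  let ?A = "{e \<in> E. u \<in> e}" and ?B = "{e \<in> E. v \<in> e}" and ?O = "{e \<in> E. u \<notin> e \<and> v \<notin> e}"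
  have uv: "u \<noteq> v" using assms by auto
  have "?A \<inter> ?B = {{u, v}}"
  proof (intro Set.set_eqI iffI)
    fix e assume "e \<in> ?A \<inter> ?B"
    then have e: "e \<in> E" "u \<in> e" "v \<in> e" by auto
    obtain w where "e = {u, w}" using edge_other[OF e(1,2)] by blast
    then show "e \<in> {{u, v}}" using e(3) uv by auto
  qed (use assms in auto)
  then have "card (?A \<union> ?B) + 1 = card ?A + card ?B"
    using card_Un_Int[of ?A ?B] by simp
  moreover have "card E = card (?A \<union> ?B) + card ?O"
    using card_filter_split[OF finite_E, of "\<lambda>e. u \<in> e \<or> v \<in> e"]
    by (simp add: Collect_disj_eq[symmetric] conj_disj_distribL)
  ultimately show ?thesis using card_edges_at by simp
qed

text \<open>Deleting the edges at \<open>u\<close> and \<open>v\<close> costs a maximum matching at most two edges. In the case of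
  equality all remaining edges belong to the matching.\<close>

lemma edge_degree_bound:
  assumes uv: "{u, v} \<in> E"
  shows "card (nbrs E u) + card (nbrs E v) + matching_number E \<le> card E + 3"
    and "card (nbrs E u) + card (nbrs E v) + matching_number E = card E + 3 \<Longrightarrow>
      (\<forall>e\<in>E. \<forall>f\<in>E. e \<inter> {u, v} = {} \<longrightarrow> f \<inter> {u, v} = {} \<longrightarrow> e \<inter> f \<noteq> {} \<longrightarrow> e = f) \<and>
      (\<exists>x y. {u, x} \<in> E \<and> {v, y} \<in> E \<and> x \<noteq> v \<and> y \<noteq> u \<and> x \<noteq> y \<and>
         nbrs E x \<subseteq> {u, v} \<and> nbrs E y \<subseteq> {u, v})"
proof -
  obtain M where M: "is_matching E M" "card M = matching_number E" by (rule maximum_matching)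
  have ME: "M \<subseteq> E" and disj: "\<And>e f w. e \<in> M \<Longrightarrow> f \<in> M \<Longrightarrow> w \<in> e \<Longrightarrow> w \<in> f \<Longrightarrow> e = f"
    using M unfolding is_matching_def by blast+
  have fin: "finite M" using finite_subset[OF ME] by simp
  let ?U = "{e \<in> M. u \<in> e}" and ?W = "{e \<in> M. v \<in> e}" and ?N = "{e \<in> M. u \<notin> e \<and> v \<notin> e}"
  let ?O = "{e \<in> E. u \<notin> e \<and> v \<notin> e}"
  have cU: "card ?U \<le> 1" and cW: "card ?W \<le> 1" using card_matching_at[OF M(1)] by blast+
  have cN: "card ?N \<le> card ?O" using ME by (intro card_mono) auto
  have cM: "card M = card (?U \<union> ?W) + card ?N"
    using card_filter_split[OF fin, of "\<lambda>e. u \<in> e \<or> v \<in> e"]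
    by (simp add: Collect_disj_eq[symmetric] conj_disj_distribL)
  have cUW: "card (?U \<union> ?W) \<le> card ?U + card ?W" by (rule card_Un_le)
  show "card (nbrs E u) + card (nbrs E v) + matching_number E \<le> card E + 3"
    using cU cW cN cM cUW card_edges_at_edge[OF uv] M(2) by linarith
  assume "card (nbrs E u) + card (nbrs E v) + matching_number E = card E + 3"
  then have eq: "card ?U = 1" "card ?W = 1" "card (?U \<union> ?W) = 2" "card ?N = card ?O"
    using cU cW cN cM cUW card_edges_at_edge[OF uv] M(2) by linarith+
  have NO: "?N = ?O" using eq(4) ME by (intro card_subset_eq) auto
  obtain e where e: "?U = {e}" using eq(1) by (auto simp: card_1_singleton_iff)
  obtain f where f: "?W = {f}" using eq(2) by (auto simp: card_1_singleton_iff)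
  have ef: "e \<noteq> f"
  proof
    assume "e = f"
    then have "card (?U \<union> ?W) = 1" unfolding e f by simp
    then show False using eq(3) by simp
  qed
  have e': "e \<in> M" "u \<in> e" and f': "f \<in> M" "v \<in> f" using e f by auto
  obtain x where x: "e = {u, x}" using edge_other[of e u] e' ME by auto
  obtain y where y: "f = {v, y}" using edge_other[of f v] f' ME by auto
  have dj: "e \<inter> f = {}" using disj e' f' ef by blast
  have uxE: "{u, x} \<in> E" "{v, y} \<in> E" using ME e' f' unfolding x y by blast+
  have ne: "x \<noteq> u" "y \<noteq> v" "x \<noteq> v" "y \<noteq> u" "x \<noteq> y"
    using uxE dj unfolding x y by auto
  \<comment> \<open>x and y are the other ends of the matching edges at u and v. By
    \<open>NO\<close> a further edge at x or y avoiding u and v would itself lie in the matching and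
    meet one of those two.\<close>
  have unm: "nbrs E w \<subseteq> {u, v}" if w: "w = x \<or> w = y" for w
  proof
    fix z assume z: "z \<in> nbrs E w"
    show "z \<in> {u, v}"
    proof (rule ccontr)
      assume "z \<notin> {u, v}"
      moreover have "w \<noteq> u" "w \<noteq> v" using w ne by auto
      ultimately have "{w, z} \<in> ?O" using z by auto
      then have wz: "{w, z} \<in> M" "u \<notin> {w, z}" "v \<notin> {w, z}" using NO by blast+
      have "{w, z} \<noteq> e" "{w, z} \<noteq> f" using wz(2,3) e'(2) f'(2) by blast+
      moreover have "w \<in> e \<or> w \<in> f" using w unfolding x y by blast
      ultimately show False using disj[OF wz(1) e'(1)] disj[OF wz(1) f'(1)] by blast
    qed
  qed
  have "e1 = e2" if "e1 \<in> E" "e2 \<in> E" "e1 \<inter> {u, v} = {}" "e2 \<inter> {u, v} = {}" "e1 \<inter> e2 \<noteq> {}" for e1 e2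
  proof -
    have "e1 \<in> ?N" "e2 \<in> ?N" unfolding NO using that by auto
    then show ?thesis using disj that(5) by blast
  qed
  moreover have "{u, x} \<in> E" "{v, y} \<in> E" "x \<noteq> v" "y \<noteq> u" "x \<noteq> y"
    by fact+
  moreover have "nbrs E x \<subseteq> {u, v}" "nbrs E y \<subseteq> {u, v}" using unm by simp_all
  ultimately show "(\<forall>e\<in>E. \<forall>f\<in>E. e \<inter> {u, v} = {} \<longrightarrow> f \<inter> {u, v} = {} \<longrightarrow> e \<inter> f \<noteq> {} \<longrightarrow> e = f) \<and>
      (\<exists>x y. {u, x} \<in> E \<and> {v, y} \<in> E \<and> x \<noteq> v \<and> y \<noteq> u \<and> x \<noteq> y \<and>
         nbrs E x \<subseteq> {u, v} \<and> nbrs E y \<subseteq> {u, v})"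
    by (intro conjI ballI impI exI[of _ x] exI[of _ y]) simp_all
qed

lemma eigenvalue_degree_bound:
  assumes deg: "\<And>w. w \<in> V \<Longrightarrow> card (nbrs E w) * card (nbrs E w) + (\<Sum>x\<in>nbrs E w. card (nbrs E x))
      \<le> s * card (nbrs E w)"
    and mu: "Q_eigenvalue V E mu"
  shows "mu \<le> real s"
proof (rule eigenvalue_bound(1)[OF _ _ mu])
  \<comment> \<open>The maximum with 1 keeps the vector positive at isolated vertices.\<close>
  define y where "y w = real (max 1 (card (nbrs E w)))" for w
  show "y w > 0" for w by (simp add: y_def)
  fix w assume w: "w \<in> V"
  have y_pos: "y x = real (card (nbrs E x))" if "x \<in> nbrs E x'" for x x'
  proof -
    have "x' \<in> nbrs E x" using that by (simp add: insert_commute)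
    then have "card (nbrs E x) \<ge> 1" by (metis card_gt_0_iff empty_iff finite_nbrs less_eq_Suc_le One_nat_def)
    then show ?thesis by (simp add: y_def)
  qed
  show "real (card (nbrs E w)) * y w + sum y (nbrs E w) \<le> real s * y w"
  proof (cases "nbrs E w = {}")
    case False
    then obtain x where "x \<in> nbrs E w" by blast
    then have "w \<in> nbrs E x" by (simp add: insert_commute)
    then have "y w = real (card (nbrs E w))" by (rule y_pos)
    moreover have "sum y (nbrs E w) = real (\<Sum>x\<in>nbrs E w. card (nbrs E x))"
      unfolding of_nat_sum by (rule sum.cong[OF refl]) (rule y_pos)
    moreover have "real (card (nbrs E w) * card (nbrs E w) + (\<Sum>x\<in>nbrs E w. card (nbrs E x)))
        \<le> real (s * card (nbrs E w))"
      using deg[OF w] by (rule of_nat_mono)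
    ultimately show ?thesis by simp
  qed (simp add: y_def)
qed

text \<open>The known bound of q by the largest degree sum of an edge: d(w)^2 plus the degrees of
  the neighbours of w is the sum of d(w) + d(x) over these neighbours x.\<close>

lemma eigenvalue_edge_degree_bound:
  assumes "\<And>w x. {w, x} \<in> E \<Longrightarrow> card (nbrs E w) + card (nbrs E x) \<le> s" "Q_eigenvalue V E mu"
  shows "mu \<le> real s"
proof (rule eigenvalue_degree_bound[OF _ assms(2)])
  fix w
  have "(\<Sum>x\<in>nbrs E w. card (nbrs E w) + card (nbrs E x)) \<le> (\<Sum>x\<in>nbrs E w. s)"
    using assms(1) by (intro sum_mono) auto
  then show "card (nbrs E w) * card (nbrs E w) + (\<Sum>x\<in>nbrs E w. card (nbrs E x)) \<le> s * card (nbrs E w)"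
    by (simp add: sum.distrib mult.commute)
qed

end

text \<open>An edge attaining the bound of \<open>edge_degree_bound\<close>.\<close>

locale tight = sgraph +
  fixes u v x y :: 'a
  assumes uv: "{u, v} \<in> E" and ux: "{u, x} \<in> E" and vy: "{v, y} \<in> E"
    and xv: "x \<noteq> v" and yu: "y \<noteq> u" and xy: "x \<noteq> y"
    and nbrs_x: "nbrs E x \<subseteq> {u, v}" and nbrs_y: "nbrs E y \<subseteq> {u, v}"
    and disjoint: "\<And>e f. e \<in> E \<Longrightarrow> f \<in> E \<Longrightarrow> e \<inter> {u, v} = {} \<Longrightarrow> f \<inter> {u, v} = {} \<Longrightarrow>
      e \<inter> f \<noteq> {} \<Longrightarrow> e = f"
begin

lemma distinct: "u \<noteq> v" "x \<noteq> u" "y \<noteq> v" using uv ux vy by auto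

lemma edge_sym: "{p, q} \<in> E \<Longrightarrow> {q, p} \<in> E" by (simp add: insert_commute)

lemma outside_unique:
  assumes "w \<notin> {u, v}" "{w, p} \<in> E" "{w, q} \<in> E" "p \<notin> {u, v}" "q \<notin> {u, v}"
  shows "p = q"
proof -
  have "{w, p} = {w, q}" by (rule disjoint) (use assms in auto)
  then show ?thesis by (auto simp: doubleton_eq_iff)
qed

lemma tight_sym: "tight V E v u y x"
  using uv ux vy xv yu xy nbrs_x nbrs_y disjoint
  by unfold_locales (auto simp: insert_commute)

lemma card_nbrs_outside: assumes "w \<notin> {u, v}" shows "card (nbrs E w) \<le> 3"
proof -
  have "card (nbrs E w - {u, v}) \<le> 1"
    unfolding One_nat_def using outside_unique[OF assms] by (subst card_le_Suc0_iff_eq) simp_all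
  moreover have "card (nbrs E w) \<le> card (nbrs E w - {u, v}) + card {u, v}"
    by (rule diff_card_le_card_Diff[THEN le_diff_conv[THEN iffD1]]) simp
  ultimately show ?thesis using distinct by simp
qed

text \<open>The neighbours of u contribute at most d(v) + 2 + 3 * (d(u) - 2): x has degree at most
  2, and those other than v and x at most 3. The required bound minus this is (d(v) - 4) * (d(u) -
  1).\<close>

lemma sum_degrees_u:
  assumes "card (nbrs E u) \<ge> 4" "card (nbrs E v) \<ge> 4"
  shows "card (nbrs E u) * card (nbrs E u) + (\<Sum>w\<in>nbrs E u. card (nbrs E w))
    \<le> (card (nbrs E u) + card (nbrs E v) - 1) * card (nbrs E u)"
proof -
  let ?d = "\<lambda>w. card (nbrs E w)"
  have mem: "v \<in> nbrs E u" "x \<in> nbrs E u - {v}" using uv ux xv by simp_all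
  have "card (nbrs E x) \<le> card {u, v}" using nbrs_x by (intro card_mono) auto
  then have x2: "?d x \<le> 2" using distinct by simp
  have "(\<Sum>w\<in>nbrs E u - {v} - {x}. ?d w) \<le> (\<Sum>w\<in>nbrs E u - {v} - {x}. 3)"
  proof (rule sum_mono)
    fix w assume "w \<in> nbrs E u - {v} - {x}"
    then have "w \<notin> {u, v}" by auto
    then show "?d w \<le> 3" by (rule card_nbrs_outside)
  qed
  also have "\<dots> = 3 * (?d u - 2)" using mem by (simp add: card_Diff_singleton_if del: mem_nbrs)
  finally have "sum ?d (nbrs E u) \<le> ?d v + (2 + 3 * (?d u - 2))"
    using x2 mem by (simp add: sum.remove[of _ v] sum.remove[of _ x] del: mem_nbrs)
  moreover obtain p q where "?d u = 4 + p" "?d v = 4 + q" using assms by (metis le_iff_add)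
  ultimately show ?thesis by (simp add: algebra_simps)
qed

lemma eigenvalue_le_of_degrees_ge_4:
  assumes d: "card (nbrs E u) \<ge> 4" "card (nbrs E v) \<ge> 4" and mu: "Q_eigenvalue V E mu"
  shows "mu \<le> real (card (nbrs E u) + card (nbrs E v) - 1)"
proof (rule eigenvalue_degree_bound[OF _ mu])
  let ?d = "\<lambda>w. card (nbrs E w)"
  interpret T: tight V E v u y x by (rule tight_sym)
  fix w
  show "?d w * ?d w + sum ?d (nbrs E w) \<le> (?d u + ?d v - 1) * ?d w"
  proof (cases "w \<in> {u, v}")
    case True
    then show ?thesis using sum_degrees_u[OF d] T.sum_degrees_u[OF d(2,1)] by (auto simp: add.commute)
  next
    case False
    \<comment> \<open>Away from u and v all degrees are at most 3, so 3 + d(u) is absorbed by d(v)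
      \<ge> 4, and symmetrically.\<close>
    have "?d w + ?d z \<le> ?d u + ?d v - 1" for z
      using card_nbrs_outside[OF False] card_nbrs_outside[of z] d by (cases "z \<in> {u, v}") auto
    then have "(\<Sum>z\<in>nbrs E w. ?d w + ?d z) \<le> (\<Sum>z\<in>nbrs E w. ?d u + ?d v - 1)"
      by (intro sum_mono)
    then show ?thesis by (simp add: sum.distrib mult.commute)
  qed
qed

lemma nbrs_v_2: assumes "card (nbrs E v) = 2" shows "nbrs E v = {u, y}"
  using card_subset_eq[of "nbrs E v" "{u, y}"] assms uv vy yu by (auto simp: insert_commute)

text \<open>Here v has only the neighbours u and y, and y has none outside {u, v}. So vy is isolated
  once u is removed, like the other edges that avoid u.\<close>

lemma hub_2: assumes "card (nbrs E v) = 2" shows "hub V E u {}"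
proof unfold_locales
  have nv: "q = u \<or> q = y" if "{v, q} \<in> E" for q 
  proof -
    have "q \<in> nbrs E v" using that by simp
    then show ?thesis unfolding nbrs_v_2[OF assms] by simp
  qed
  fix w p q assume w: "w \<noteq> u" "{w, p} \<in> E" "{w, q} \<in> E" "p \<noteq> u" "q \<noteq> u"
  show "p = q"
  proof (cases "w \<in> {v, y}")
    case True
    moreover have "q = u \<or> q = v" if "{y, q} \<in> E" for q
    proof -
      have "q \<in> nbrs E y" using that by simp
      then show ?thesis using nbrs_y by blast
    qed
    ultimately show ?thesis using w nv by blast
  next
    case False
    then have "p \<noteq> v" "q \<noteq> v" using w nv edge_sym by blast+
    then show ?thesis using outside_unique[of w p q] w False by auto
  qed
qed (use uv edge_in_V in auto)


text \<open>Since v is adjacent only to u and y, the vertex x is pendant at u; this supplies a'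
  \<ge> 1 for the extremal comparison.\<close>

lemma hub_2_counts:
  assumes d: "card (nbrs E v) = 2"
  shows "hub.pends E u {} \<noteq> {}" and "card (hub.rest_edges E u {}) + card (nbrs E u) = card E"
proof -
  interpret H: hub V E u "{}" by (rule hub_2[OF d])
  have "v \<notin> nbrs E x"
  proof
    assume "v \<in> nbrs E x"
    then have "x \<in> nbrs E v" using edge_sym by simp
    then show False using nbrs_v_2[OF d] distinct xy by blast
  qed
  then have "nbrs E x = {u}" using nbrs_x edge_sym[OF ux] by auto
  then have "x \<in> H.pends" unfolding H.pends_def using ux by simp
  then show "H.pends \<noteq> {}" by blast
  show "card H.rest_edges + card (nbrs E u) = card E"
    using card_filter_split[OF finite_E, of "\<lambda>e. u \<in> e"] card_edges_at[of u]
    by (simp add: H.rest_edges_def)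
qed

lemma nbrs_v_3:
  assumes "card (nbrs E v) = 3"
  obtains z where "nbrs E v = {u, y, z}" "z \<noteq> u" "z \<noteq> y" "z \<noteq> v"
proof -
  have sub: "{u, y} \<subseteq> nbrs E v" using uv vy edge_sym by auto
  then have "card (nbrs E v - {u, y}) = 1"
    using assms yu by (simp add: card_Diff_subset)
  then obtain z where z: "nbrs E v - {u, y} = {z}" by (auto simp: card_1_singleton_iff)
  show thesis
  proof (rule that)
    show "nbrs E v = {u, y, z}" using z sub by blast
    show "z \<noteq> u" "z \<noteq> y" using z by blast+
    show "z \<noteq> v" using z nbrs_irrefl by blast
  qed
qed

end

section \<open>Degree three: numerical estimates\<close>

lemma root_lower_bound:
  fixes t :: nat and r :: real
  assumes t: "t \<ge> 3" and r: "r > t + 2" "r \<ge> real (t + 1) + ((real t - 1) * pend_wt r + 2 * tri_wt r)"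
  shows "r \<ge> 53 / 10"
proof (rule ccontr)
  assume "\<not> r \<ge> 53 / 10"
  \<comment> \<open>Only t = 3 is critical, where merely r > 5 is known. At r = 5 the inequality for
    \<open>(2 * r - 4) / D'\<close> in \<open>matched_wts\<close> fails, so the second hypothesis is
    used to improve 5 to 5.3.\<close>
  then have lt: "r < 53 / 10" by simp
  then have "t = 3" using t r(1) by linarith
  then have r': "r > 5" "r \<ge> 4 + (2 * pend_wt r + 2 * tri_wt r)" using r by simp_all
  have "10 / 43 \<le> pend_wt r" "10 / 23 \<le> tri_wt r"
    using lt r' by (simp_all add: pend_wt_def tri_wt_def divide_simps)
  then show False using r' lt by linarith
qed

text \<open>\<open>S_max\<close> is applied to the graph in which the part hanging on \<open>B\<close> is replaced by one triangle
  and \<open>n\<close> pendant edges. This raises the degree of \<open>u\<close> by one, so the neighbours of \<open>u\<close> in \<open>B\<close> may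
  weigh up to \<open>1\<close> more than the replacement.\<close>

lemma (in hub) eigenvalue_less_hub_replace:
  fixes t \<beta> :: nat and r S :: real
  assumes S_max: "\<And>a b c. a \<ge> 1 \<Longrightarrow> a + b + 2 * c = t + 1 \<Longrightarrow> b + c + 1 \<le> \<beta> \<Longrightarrow> S_sum a b c r \<le> S"
    and r: "r = real (t + 1) + S" "r > 3"
    and t: "card (nbrs E u) = t" and \<beta>: "card rest_edges + 2 \<le> \<beta>"
    and n: "card (nbrs E u \<inter> B) = Suc n" "card pends + n \<ge> 1"
    and N: "\<And>w. w \<in> B \<Longrightarrow> nbrs E w - {u} = N w"
    and y_pos: "\<And>w. w \<in> B \<Longrightarrow> y w > 0"
    and y_sup: "\<And>w i. w \<in> B \<Longrightarrow> i = (if {u, w} \<in> E then 1 else 0) \<Longrightarrow>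
        (real (card (N w)) + i) * y w + i + sum y (N w) \<le> r * y w"
    and reach: "\<And>w. w \<in> B \<Longrightarrow> (\<lambda>s t. {s, t} \<in> E)\<^sup>*\<^sup>* w u"
    and small: "sum y (nbrs E u \<inter> B) < 1 + n * pend_wt r + 2 * tri_wt r"
    and mu: "Q_eigenvalue V E mu"
  shows "mu < r"
proof (rule eigenvalue_less_hub[OF r(2) y_pos _ reach _ mu])
  have "S_sum (card pends + n) (card mids) (Suc (card tri_edges)) r \<le> S"
    using card_nbrs_hub t n card_mids_tri_edges \<beta> by (intro S_max) auto
  then show "real (card (nbrs E u)) + sum y (nbrs E u \<inter> B)
      + S_sum (card pends) (card mids) (card tri_edges) r < r"
    using small r(1) t unfolding S_sum_Suc by simp
next
  fix w assume w: "w \<in> B"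
  define i :: real where "i = (if {u, w} \<in> E then 1 else 0)"
  have "card (nbrs E w) = (if {u, w} \<in> E then 1 else 0) + card (nbrs E w - {u})"
  proof (cases "{u, w} \<in> E")
    case True
    then have "u \<in> nbrs E w" by (simp add: insert_commute)
    then show ?thesis using True card.remove[OF finite_nbrs] by force
  next
    case False
    then have "u \<notin> nbrs E w" by (simp add: insert_commute)
    then show ?thesis using False by (simp del: mem_nbrs)
  qed
  then have "real (card (nbrs E w)) = real (card (N w)) + i"
    unfolding N[OF w] by (simp add: i_def)
  then show "real (card (nbrs E w)) * y w
        + ((if {u, w} \<in> E then 1 else 0) + sum y (nbrs E w - {u})) \<le> r * y w"
    unfolding N[OF w] using y_sup[OF w i_def] unfolding i_def[symmetric] by simp
qed

lemma quartic_pos: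
  assumes "s \<ge> 0" "a > 0" "b \<ge> 0" "c \<ge> 0" "d \<ge> 0"
  shows "a + b * s + c * s^2 + d * s^3 + s^4 > (0::real)"
  using assms by (intro add_pos_nonneg mult_nonneg_nonneg zero_le_power)

text \<open>The fractions below are the weights given to the vertices near \<open>v\<close> when \<open>v\<close> has degree three.
  In terms of the distance \<open>s\<close> of \<open>r\<close> from its lower bound (scaled to avoid denominators) each inequality
  says that a quartic with positive coefficients is positive.\<close>

lemma frac_less_wts:
  assumes "r > 3" "D > 0" "N * ((r - 1) * (r - 3)) < D * ((r - 1) * (r - 3) + k * (r - 3) + 2 * (r - 1))"
  shows "N / D < 1 + k * pend_wt r + 2 * tri_wt r"
proof -
  have p: "(r - 1) * (r - 3) > 0" using assms(1) by simp
  have "1 + k * pend_wt r + 2 * tri_wt r = ((r - 1) * (r - 3) + k * (r - 3) + 2 * (r - 1)) / ((r - 1) * (r - 3))"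
    using assms(1) by (simp add: pend_wt_def tri_wt_def divide_simps) (simp add: algebra_simps)
  moreover have "N / D < x / p" if "N * p < D * x" "p > 0" for x p :: real
    using that assms(2) by (simp add: divide_simps mult.commute)
  ultimately show ?thesis using assms(3) p by simp
qed

text \<open>These serve a path y - v - z - z' attached to u, with weight \<alpha> inside and
  \<gamma> at the ends. \<open>D\<close> is (r - 4) * (r - 1) - 1 and \<open>D'\<close> is (r - 4) *
  (r - 2) - 1, the determinants of the equations for \<alpha> and \<gamma> when u sees no end,
  respectively some end. The fractions are \<alpha>, 2\<alpha>, \<alpha> + \<gamma>, 2\<alpha> +
  \<gamma> and 2\<alpha> + 2\<gamma>; the factor of \<open>pend_wt\<close> is the number of
  neighbours of u on the path other than v.\<close>

lemma matched_wts:
  assumes r: "(r::real) \<ge> 53 / 10"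
  defines "D \<equiv> r\<^sup>2 - 5 * r + 3" and "D' \<equiv> r\<^sup>2 - 6 * r + 7"
  shows "D > 0" "D' > 0"
    "(r - 1) / D < 1 + 0 * pend_wt r + 2 * tri_wt r"
    "(2 * r - 2) / D < 1 + 1 * pend_wt r + 2 * tri_wt r"
    "(2 * r - 4) / D' < 1 + 1 * pend_wt r + 2 * tri_wt r"
    "r > 6 \<Longrightarrow> (3 * r - 5) / D' < 1 + 2 * pend_wt r + 2 * tri_wt r"
    "r > 7 \<Longrightarrow> (4 * r - 8) / D' < 1 + 3 * pend_wt r + 2 * tri_wt r"
proof -
  define s where "s = 10 * r - 53"
  have s: "s \<ge> 0" using r by (simp add: s_def)
  have "100 * D = s * s + 56 * s + 459" by (simp add: D_def s_def power2_eq_square algebra_simps)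
  moreover have "s * s + 56 * s + 459 > 0" using s by (simp add: add_nonneg_pos)
  ultimately show D: "D > 0" by linarith
  have "100 * D' = s * s + 46 * s + 329" by (simp add: D'_def s_def power2_eq_square algebra_simps)
  moreover have "s * s + 46 * s + 329 > 0" using s by (simp add: add_nonneg_pos)
  ultimately show D': "D' > 0" by linarith
  show "(r - 1) / D < 1 + 0 * pend_wt r + 2 * tri_wt r"
  proof (rule frac_less_wts)
    have "10000 * (D * ((r - 1) * (r - 3) + 0 * (r - 3) + 2 * (r - 1)) - (r - 1) * ((r - 1) * (r - 3))) = 423421 + 104748 * s + 6034 * s^2 + 132 * s^3 + s^4"
      by (simp add: D_def s_def algebra_simps power2_eq_square power3_eq_cube power4_eq_xxxx)
    also have "\<dots> > 0" using s by (intro quartic_pos) auto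
    finally show "(r - 1) * ((r - 1) * (r - 3)) < D * ((r - 1) * (r - 3) + 0 * (r - 3) + 2 * (r - 1))" by simp
  qed (use r D D' in auto)
  show "(2 * r - 2) / D < 1 + 1 * pend_wt r + 2 * tri_wt r"
  proof (rule frac_less_wts)
    have "10000 * (D * ((r - 1) * (r - 3) + 1 * (r - 3) + 2 * (r - 1)) - (2 * r - 2) * ((r - 1) * (r - 3))) = 103721 + 83948 * s + 5734 * s^2 + 132 * s^3 + s^4"
      by (simp add: D_def s_def algebra_simps power2_eq_square power3_eq_cube power4_eq_xxxx)
    also have "\<dots> > 0" using s by (intro quartic_pos) auto
    finally show "(2 * r - 2) * ((r - 1) * (r - 3)) < D * ((r - 1) * (r - 3) + 1 * (r - 3) + 2 * (r - 1))" by simp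
  qed (use r D D' in auto)
  show "(2 * r - 4) / D' < 1 + 1 * pend_wt r + 2 * tri_wt r"
  proof (rule frac_less_wts)
    have "10000 * (D' * ((r - 1) * (r - 3) + 1 * (r - 3) + 2 * (r - 1)) - (2 * r - 4) * ((r - 1) * (r - 3))) = 31251 + 63878 * s + 4844 * s^2 + 122 * s^3 + s^4"
      by (simp add: D'_def s_def algebra_simps power2_eq_square power3_eq_cube power4_eq_xxxx)
    also have "\<dots> > 0" using s by (intro quartic_pos) auto
    finally show "(2 * r - 4) * ((r - 1) * (r - 3)) < D' * ((r - 1) * (r - 3) + 1 * (r - 3) + 2 * (r - 1))" by simp
  qed (use r D D' in auto)
  show "(3 * r - 5) / D' < 1 + 2 * pend_wt r + 2 * tri_wt r" if r6: "r > 6"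
  proof (rule frac_less_wts)
    define s where "s = r - 6"
    have s: "s \<ge> 0" using r6 by (simp add: s_def)
    have "D' * ((r - 1) * (r - 3) + 2 * (r - 3) + 2 * (r - 1)) - (3 * r - 5) * ((r - 1) * (r - 3)) = 22 + 121 * s + 73 * s^2 + 15 * s^3 + s^4"
      by (simp add: D'_def s_def algebra_simps power2_eq_square power3_eq_cube power4_eq_xxxx)
    also have "\<dots> > 0" using s by (intro quartic_pos) auto
    finally show "(3 * r - 5) * ((r - 1) * (r - 3)) < D' * ((r - 1) * (r - 3) + 2 * (r - 3) + 2 * (r - 1))" by simp
  qed (use r D D' in auto)
  show "(4 * r - 8) / D' < 1 + 3 * pend_wt r + 2 * tri_wt r" if r7: "r > 7"
  proof (rule frac_less_wts)
    define s where "s = r - 7"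
    have s: "s \<ge> 0" using r7 by (simp add: s_def)
    have "D' * ((r - 1) * (r - 3) + 3 * (r - 3) + 2 * (r - 1)) - (4 * r - 8) * ((r - 1) * (r - 3)) = 192 + 298 * s + 122 * s^2 + 19 * s^3 + s^4"
      by (simp add: D'_def s_def algebra_simps power2_eq_square power3_eq_cube power4_eq_xxxx)
    also have "\<dots> > 0" using s by (intro quartic_pos) auto
    finally show "(4 * r - 8) * ((r - 1) * (r - 3)) < D' * ((r - 1) * (r - 3) + 3 * (r - 3) + 2 * (r - 1))" by simp
  qed (use r D D' in auto)
qed

text \<open>This serves a path y - v - z attached to u, with n of its ends adjacent to u. The
  denominator is (r - 3) * (r - 2) - 2, the determinant of the equations for the weights at v and at
  the ends.\<close>

lemma unmatched_wts:
  assumes r: "(r::real) \<ge> 53 / 10" and n: "n \<le> (2::nat)"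
  shows "(r + n * (r - 2)) / ((r - 1) * (r - 4)) < 1 + n * pend_wt r + 2 * tri_wt r"
proof -
  define s where "s = 10 * r - 53"
  have s: "s \<ge> 0" using r by (simp add: s_def)
  have "(r + 0 * (r - 2)) / ((r - 1) * (r - 4)) < 1 + 0 * pend_wt r + 2 * tri_wt r"
  proof (rule frac_less_wts)
    have "10000 * (((r - 1) * (r - 4)) * ((r - 1) * (r - 3) + 0 * (r - 3) + 2 * (r - 1)) - (r + 0 * (r - 2)) * ((r - 1) * (r - 3))) = 509421 + 106748 * s + 6034 * s^2 + 132 * s^3 + s^4"
      by (simp add: s_def algebra_simps power2_eq_square power3_eq_cube power4_eq_xxxx)
    also have "\<dots> > 0" using s by (intro quartic_pos) auto
    finally show "(r + 0 * (r - 2)) * ((r - 1) * (r - 3)) < ((r - 1) * (r - 4)) * ((r - 1) * (r - 3) + 0 * (r - 3) + 2 * (r - 1))" by simp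
  qed (use r in auto)
  moreover have "(r + 1 * (r - 2)) / ((r - 1) * (r - 4)) < 1 + 1 * pend_wt r + 2 * tri_wt r"
  proof (rule frac_less_wts)
    have "10000 * (((r - 1) * (r - 4)) * ((r - 1) * (r - 3) + 1 * (r - 3) + 2 * (r - 1)) - (r + 1 * (r - 2)) * ((r - 1) * (r - 3))) = 311621 + 93548 * s + 5834 * s^2 + 132 * s^3 + s^4"
      by (simp add: s_def algebra_simps power2_eq_square power3_eq_cube power4_eq_xxxx)
    also have "\<dots> > 0" using s by (intro quartic_pos) auto
    finally show "(r + 1 * (r - 2)) * ((r - 1) * (r - 3)) < ((r - 1) * (r - 4)) * ((r - 1) * (r - 3) + 1 * (r - 3) + 2 * (r - 1))" by simp
  qed (use r in auto)
  moreover have "(r + 2 * (r - 2)) / ((r - 1) * (r - 4)) < 1 + 2 * pend_wt r + 2 * tri_wt r"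
  proof (rule frac_less_wts)
    have "10000 * (((r - 1) * (r - 4)) * ((r - 1) * (r - 3) + 2 * (r - 3) + 2 * (r - 1)) - (r + 2 * (r - 2)) * ((r - 1) * (r - 3))) = 113821 + 80348 * s + 5634 * s^2 + 132 * s^3 + s^4"
      by (simp add: s_def algebra_simps power2_eq_square power3_eq_cube power4_eq_xxxx)
    also have "\<dots> > 0" using s by (intro quartic_pos) auto
    finally show "(r + 2 * (r - 2)) * ((r - 1) * (r - 3)) < ((r - 1) * (r - 4)) * ((r - 1) * (r - 3) + 2 * (r - 3) + 2 * (r - 1))" by simp
  qed (use r in auto)
  moreover have "n = 0 \<or> n = 1 \<or> n = 2" using n by auto
  ultimately show ?thesis by auto
qed

section \<open>Degree three: the test vectors\<close>

context tight
begin

text \<open>Let z be the third neighbour of v. Without u, the component of v is the path y - v - z,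
  or y - v - z - z' if z lies on an edge avoiding u and v, and the other edges are disjoint. This
  path is taken as B, and its weights solve the local equations in the presence of edges to
  u.\<close>

lemma eigenvalue_less_3:
  fixes t \<beta> :: nat and r S :: real
  assumes S_max: "\<And>a b c. a \<ge> 1 \<Longrightarrow> a + b + 2 * c = t + 1 \<Longrightarrow> b + c + 1 \<le> \<beta> \<Longrightarrow> S_sum a b c r \<le> S"
    and r: "r = real (t + 1) + S" "r > t + 2"
    and t: "t \<ge> 3" "card (nbrs E u) = t" and dv: "card (nbrs E v) = 3"
    and \<beta>: "card E = \<beta> + t" "\<beta> \<ge> 2"
    and mu: "Q_eigenvalue V E mu"
  shows "mu < r"
proof -
  \<comment> \<open>One triangle and t - 1 pendant edges form an admissible competitor because
    \<beta> \<ge> 2.\<close>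
  have "S_sum (t - 1) 0 1 r \<le> S" using t \<beta> by (intro S_max) auto
  then have "r \<ge> real (t + 1) + ((real t - 1) * pend_wt r + 2 * tri_wt r)"
    using r(1) t(1) by (simp add: S_sum_def of_nat_diff)
  then have r53: "r \<ge> 53 / 10" using r(2) t(1) by (intro root_lower_bound) auto
  then have r3: "r > 3" by simp
  let ?O = "{e \<in> E. u \<notin> e \<and> v \<notin> e}"
  have O: "card ?O + 2 = \<beta>" using card_edges_at_edge[OF uv] t dv \<beta> by simp
  obtain z where nv: "nbrs E v = {u, y, z}" and z: "z \<noteq> u" "z \<noteq> y" "z \<noteq> v"
    using nbrs_v_3[OF dv] by blast
  have nvE: "{v, q} \<in> E \<longleftrightarrow> q = u \<or> q = y \<or> q = z" for q
    using nv unfolding nbrs_def by blast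
  have nvE': "{q, v} \<in> E \<longleftrightarrow> q = u \<or> q = y \<or> q = z" for q
    using nvE[of q] edge_sym by blast
  have nyE: "nbrs E y - {u} = {v}"
    using nbrs_y nvE'[of y] yu distinct unfolding nbrs_def by blast
  have rest: "p = q" if "w \<noteq> u" "w \<noteq> v" "w \<noteq> y" "w \<noteq> z" "{w, p} \<in> E" "{w, q} \<in> E" "p \<noteq> u" "q \<noteq> u" for w p q
    using outside_unique[of w p q] that nvE' by blast
  have Nv: "nbrs E v - {u} = {y, z}" using nv yu z by blast
  have x_adj: "{x, v} \<in> E \<longleftrightarrow> x = z" using nvE'[of x] distinct xy by simp
  have nx: "nbrs E x = {u}" if "x \<noteq> z"
    using nbrs_x edge_sym[OF ux] x_adj that unfolding nbrs_def by blast
  have reach_u: "(\<lambda>s t. {s, t} \<in> E)\<^sup>*\<^sup>* v u" using edge_sym[OF uv] by (rule r_into_rtranclp)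
  have reach_v: "(\<lambda>s t. {s, t} \<in> E)\<^sup>*\<^sup>* w u" if "w = y \<or> w = z" for w
    using that nvE'[of w] reach_u by (auto intro: converse_rtranclp_into_rtranclp)
  show "mu < r"
  proof (cases "nbrs E z \<subseteq> {u, v}")
    case True
    define B where "B = {v, y, z}"
    have nzE: "nbrs E z - {u} = {v}"
      using True nvE'[of z] z distinct unfolding nbrs_def by blast
    interpret H: hub V E u B
    proof
      fix w q assume "w \<in> B" "{w, q} \<in> E" "q \<noteq> u"
      then have "q \<in> nbrs E w - {u}" "w = v \<or> w = y \<or> w = z" by (auto simp: B_def)
      then show "q \<in> B" using Nv nyE nzE unfolding B_def by blast
    next
      fix w p q assume "w \<noteq> u" "w \<notin> B" "{w, p} \<in> E" "{w, q} \<in> E" "p \<noteq> u" "q \<noteq> u"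
      then show "p = q" using rest[of w p q] by (simp add: B_def)
    qed (use uv vy nvE[of z] edge_in_V z yu distinct in \<open>auto simp: B_def\<close>)
    define iy iz :: nat where "iy = (if {u, y} \<in> E then 1 else 0)" and "iz = (if {u, z} \<in> E then 1 else 0)"
    \<comment> \<open>Solution of the equations \<open>e1\<close> and \<open>e2\<close>, in which
      both ends are adjacent to u; at an end not adjacent to u they leave slack
      (\<open>e3\<close>).\<close>
    define \<alpha> \<gamma> where "\<alpha> = r / ((r - 1) * (r - 4))" and "\<gamma> = (r - 2) / ((r - 1) * (r - 4))"
    define f where "f w = (if w = v then \<alpha> else \<gamma>)" for w
    define N where "N w = (if w = v then {y, z} else {v})" for w
    have sumB: "(\<Sum>w\<in>nbrs E u \<inter> B. h w) = h v + of_nat iy * h y + of_nat iz * h z"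
      for h :: "'a \<Rightarrow> 'b::semiring_1"
    proof -
      have "(\<Sum>w\<in>nbrs E u \<inter> B. h w) = (\<Sum>w\<in>B. if w \<in> nbrs E u then h w else 0)"
        by (subst Int_commute, rule sum.inter_restrict) (simp add: B_def)
      then show ?thesis using uv z distinct by (simp add: B_def iy_def iz_def ac_simps)
    qed
    have pos: "\<alpha> > 0" "\<gamma> > 0" using r53 by (auto simp: \<alpha>_def \<gamma>_def)
    have D: "(r - 1) * (r - 4) > 0" using r53 by simp
    have e1: "3 * \<alpha> + 1 + 2 * \<gamma> = r * \<alpha>" and e2: "2 * \<gamma> + 1 + \<alpha> = r * \<gamma>"
    proof -
      have "r - 1 \<noteq> 0" "r - 4 \<noteq> 0" using r53 by auto
      then show "3 * \<alpha> + 1 + 2 * \<gamma> = r * \<alpha>" "2 * \<gamma> + 1 + \<alpha> = r * \<gamma>"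
        by (simp_all add: \<alpha>_def \<gamma>_def divide_simps) (simp_all add: algebra_simps)
    qed
    have e3: "\<gamma> + \<alpha> \<le> r * \<gamma>" using e2 pos by linarith
    show ?thesis
    proof (rule H.eigenvalue_less_hub_replace[where N = N and y = f and n = "iy + iz", OF S_max r(1) r3 t(2) _ _ _ _ _ _ _ _ mu])
      have "H.rest_edges \<subseteq> ?O" unfolding H.rest_edges_def by (auto simp: B_def)
      then have "card H.rest_edges \<le> card ?O" by (intro card_mono) auto
      then show "card H.rest_edges + 2 \<le> \<beta>" using O by simp
      show "card (nbrs E u \<inter> B) = Suc (iy + iz)" using sumB[of "\<lambda>_. 1::nat"] by simp
      show "1 \<le> card H.pends + (iy + iz)"
      proof (cases "x = z")
        case True then show ?thesis using ux by (simp add: iz_def)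
      next
        case False
        then have "x \<in> H.pends"
          using nx ux xy xv unfolding H.pends_def by (simp add: B_def)
        then have "card H.pends > 0" by (auto simp: card_gt_0_iff)
        then show ?thesis by simp
      qed
      show "nbrs E w - {u} = N w" if "w \<in> B" for w
        using that Nv nyE nzE distinct z by (auto simp: B_def N_def simp del: mem_nbrs)
      show "f w > 0" for w using pos by (simp add: f_def)
      show "(\<lambda>s t. {s, t} \<in> E)\<^sup>*\<^sup>* w u" if "w \<in> B" for w
        using that reach_u reach_v by (auto simp: B_def)
      fix w and i :: real
      assume w: "w \<in> B" "i = (if {u, w} \<in> E then 1 else 0)"
      show "(real (card (N w)) + i) * f w + i + sum f (N w) \<le> r * f w"
        using w e1 e2 e3 uv z distinct pos
        by (auto simp: B_def N_def f_def algebra_simps)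
    next
      have "sum f (nbrs E u \<inter> B) = \<alpha> + real (iy + iz) * \<gamma>"
        using sumB[of f] z distinct by (simp add: f_def algebra_simps)
      also have "\<dots> = (r + real (iy + iz) * (r - 2)) / ((r - 1) * (r - 4))"
        by (simp add: \<alpha>_def \<gamma>_def add_divide_distrib)
      also have "\<dots> < 1 + real (iy + iz) * pend_wt r + 2 * tri_wt r"
        by (rule unmatched_wts[OF r53]) (simp add: iy_def iz_def)
      finally show "sum f (nbrs E u \<inter> B) < 1 + real (iy + iz) * pend_wt r + 2 * tri_wt r" .
    qed
  next
    case False
    then obtain z' where z': "{z, z'} \<in> E" "z' \<noteq> u" "z' \<noteq> v" unfolding nbrs_def by blast
    have z'z: "{z', z} \<in> E" "z' \<noteq> z" using z' edge_sym by auto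
    have z'y: "z' \<noteq> y"
    proof
      assume "z' = y"
      then have "z \<in> nbrs E y" using z'z by simp
      then show False using nbrs_y z by blast
    qed
    have xz: "x \<noteq> z" using z' nbrs_x unfolding nbrs_def by blast
    have xz': "x \<noteq> z'" using z'z z nbrs_x unfolding nbrs_def by blast
    have nzE: "nbrs E z - {u} = {v, z'}"
    proof -
      have "q = z'" if "{z, q} \<in> E" "q \<noteq> u" "q \<noteq> v" for q
        using outside_unique[of z q z'] that z z' by blast
      then show ?thesis using nvE'[of z] z' distinct unfolding nbrs_def by blast
    qed
    have nz'E: "nbrs E z' - {u} = {z}"
    proof -
      have "q = z" if "{z', q} \<in> E" "q \<noteq> u" for q
      proof -
        have "q \<noteq> v" using that nvE'[of z'] z' z'z z'y by blast
        then show ?thesis using outside_unique[of z' q z] that z z' z'z by blast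
      qed
      then show ?thesis using z'z z unfolding nbrs_def by blast
    qed
    define B where "B = {v, y, z, z'}"
    interpret H: hub V E u B
    proof
      fix w q assume "w \<in> B" "{w, q} \<in> E" "q \<noteq> u"
      then have "q \<in> nbrs E w - {u}" "w = v \<or> w = y \<or> w = z \<or> w = z'" by (auto simp: B_def)
      then show "q \<in> B" using Nv nyE nzE nz'E unfolding B_def by blast
    next
      fix w p q assume "w \<noteq> u" "w \<notin> B" "{w, p} \<in> E" "{w, q} \<in> E" "p \<noteq> u" "q \<noteq> u"
      then show "p = q" using rest[of w p q] by (simp add: B_def)
    qed (use uv vy nvE[of z] edge_in_V z z' yu distinct in \<open>auto simp: B_def\<close>)
    define iy iz iz' :: nat where "iy = (if {u, y} \<in> E then 1 else 0)"
      and "iz = (if {u, z} \<in> E then 1 else 0)" and "iz' = (if {u, z'} \<in> E then 1 else 0)"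
    let ?n = "iy + iz + iz'"
    \<comment> \<open>With no end adjacent to u, \<gamma> solves \<gamma> + \<alpha> = r * \<gamma>.
      As soon as one end is, both ends get the solution of 2\<gamma> + 1 + \<alpha> = r * \<gamma>,
      which leaves slack at an end not adjacent to u.\<close>
    define D where "D = (if iy + iz' = 0 then r\<^sup>2 - 5 * r + 3 else r\<^sup>2 - 6 * r + 7)"
    define \<alpha> \<gamma> where "\<alpha> = (r - 1) / D" and "\<gamma> = (if iy + iz' = 0 then 1 else r - 3) / D"
    define f where "f w = (if w = v \<or> w = z then \<alpha> else \<gamma>)" for w
    define N where "N w = (if w = v then {y, z} else if w = y then {v} else if w = z then {v, z'} else {z})" for w
    have sumB: "(\<Sum>w\<in>nbrs E u \<inter> B. h w) = h v + of_nat iy * h y + of_nat iz * h z + of_nat iz' * h z'"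
      for h :: "'a \<Rightarrow> 'b::semiring_1"
    proof -
      have "(\<Sum>w\<in>nbrs E u \<inter> B. h w) = (\<Sum>w\<in>B. if w \<in> nbrs E u then h w else 0)"
        by (subst Int_commute, rule sum.inter_restrict) (simp add: B_def)
      moreover have "v \<noteq> y" "v \<noteq> z" "v \<noteq> z'" "y \<noteq> z" "y \<noteq> z'" "z \<noteq> z'" using z z' z'z z'y distinct by blast+
      ultimately show ?thesis using uv by (simp add: B_def iy_def iz_def iz'_def ac_simps)
    qed
    have D: "D > 0" using matched_wts(1,2)[OF r53] by (simp add: D_def)
    have pos: "\<alpha> > 0" "\<gamma> > 0" using r53 D by (auto simp: \<alpha>_def \<gamma>_def)
    have e1: "4 * \<alpha> + 1 + \<gamma> \<le> r * \<alpha>"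
    proof -
      have "4 * \<alpha> + 1 + \<gamma> = r * \<alpha>"
        using D unfolding \<alpha>_def \<gamma>_def
        by (simp add: divide_simps) (simp add: D_def power2_eq_square algebra_simps)
      then show ?thesis by simp
    qed
    have e3: "2 * \<gamma> + 1 + \<alpha> \<le> r * \<gamma>" if "iy + iz' \<noteq> 0"
    proof -
      have g: "\<gamma> = (r - 3) / D" "D = r\<^sup>2 - 6 * r + 7" using that by (auto simp: \<gamma>_def D_def)
      have "2 * \<gamma> + 1 + \<alpha> = r * \<gamma>"
        unfolding \<alpha>_def g(1) using D
        by (simp add: divide_simps) (simp add: g(2) power2_eq_square algebra_simps)
      then show ?thesis by simp
    qed
    have e2: "\<gamma> + \<alpha> \<le> r * \<gamma>"
    proof (cases "iy + iz' = 0")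
      case True
      then show ?thesis using D by (simp add: \<alpha>_def \<gamma>_def divide_simps)
    next
      case False
      then show ?thesis using e3 pos by linarith
    qed
    have xp: "x \<in> H.pends" using nx xz ux xy xv xz' unfolding H.pends_def by (simp add: B_def)
    then have cp: "card H.pends \<ge> 1" by (metis H.finite_parts(1) One_nat_def Suc_leI card_gt_0_iff empty_iff)
    have n: "card (nbrs E u \<inter> B) = Suc ?n" using sumB[of "\<lambda>_. 1::nat"] by simp
    \<comment> \<open>Besides the n counted vertices u is adjacent to v and x. So n \<ge> 2 yields r
      > 6 and n \<ge> 3 yields r > 7, as the later inequalities demand.\<close>
    have nt: "?n + 2 \<le> t" using H.card_nbrs_hub t n cp by simp
    show ?thesis
    proof (rule H.eigenvalue_less_hub_replace[where N = N and y = f and n = ?n, OF S_max r(1) r3 t(2) _ n _ _ _ _ _ _ mu])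
      have "H.rest_edges \<subseteq> ?O" unfolding H.rest_edges_def by (auto simp: B_def)
      then have "card H.rest_edges \<le> card ?O" by (intro card_mono) auto
      then show "card H.rest_edges + 2 \<le> \<beta>" using O by simp
      show "1 \<le> card H.pends + ?n" using cp by simp
      show "nbrs E w - {u} = N w" if "w \<in> B" for w
        using that Nv nyE nzE nz'E distinct z z' z'y z'z by (auto simp: B_def N_def simp del: mem_nbrs)
      show "f w > 0" for w using pos by (simp add: f_def)
      show "(\<lambda>s t. {s, t} \<in> E)\<^sup>*\<^sup>* w u" if "w \<in> B" for w
        using that reach_u reach_v converse_rtranclp_into_rtranclp[of "\<lambda>s t. {s, t} \<in> E", OF z'z(1)] by (auto simp: B_def)
      fix w and i :: real
      assume w: "w \<in> B" and i: "i = (if {u, w} \<in> E then 1 else 0)"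
      have ne: "v \<noteq> y" "v \<noteq> z" "v \<noteq> z'" "y \<noteq> z" "y \<noteq> z'" "z \<noteq> z'" using z z' z'z z'y distinct by blast+
      show "(real (card (N w)) + i) * f w + i + sum f (N w) \<le> r * f w"
      proof -
        consider "w = v" | "w = y" | "w = z" | "w = z'" using w by (auto simp: B_def)
        then show ?thesis
        proof cases
          case 1 then show ?thesis using e1 ne uv i by (simp add: N_def f_def algebra_simps)
        next
          case 2 then show ?thesis
            using e2 e3 ne i by (cases "{u, y} \<in> E") (simp_all add: N_def f_def iy_def algebra_simps)
        next
          case 3 then show ?thesis
            using e1 ne i pos by (cases "{u, z} \<in> E") (simp_all add: N_def f_def algebra_simps)
        next
          case 4 then show ?thesis
            using e2 e3 ne i by (cases "{u, z'} \<in> E") (simp_all add: N_def f_def iz'_def algebra_simps)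
        qed
      qed
    next
      have "sum f (nbrs E u \<inter> B) = \<alpha> + iz * \<alpha> + real (iy + iz') * \<gamma>"
        using sumB[of f] z z' z'y z'z distinct by (simp add: f_def algebra_simps)
      also have "\<dots> < 1 + real ?n * pend_wt r + 2 * tri_wt r"
      proof (cases "iy + iz' = 0")
        case True
        then have "\<alpha> = (r - 1) / (r\<^sup>2 - 5 * r + 3)" by (simp add: \<alpha>_def D_def)
        then have "\<alpha> < 1 + 0 * pend_wt r + 2 * tri_wt r" "2 * \<alpha> < 1 + 1 * pend_wt r + 2 * tri_wt r"
          using matched_wts(3,4)[OF r53] by (simp_all add: right_diff_distrib)
        then show ?thesis using True by (auto simp: iz_def)
      next
        case False
        let ?D = "r\<^sup>2 - 6 * r + 7"
        have \<alpha>\<gamma>: "\<alpha> = (r - 1) / ?D" "\<gamma> = (r - 3) / ?D" "?D > 0"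
          using False matched_wts(2)[OF r53] by (auto simp: \<alpha>_def \<gamma>_def D_def)
        have le: "\<gamma> \<le> \<alpha>" unfolding \<alpha>\<gamma>(1,2) using \<alpha>\<gamma>(3) by (simp add: divide_right_mono)
        have w1: "\<alpha> + \<gamma> < 1 + 1 * pend_wt r + 2 * tri_wt r"
          using matched_wts(5)[OF r53] unfolding \<alpha>\<gamma>(1,2) add_divide_distrib[symmetric] by simp
        have w2: "2 * \<alpha> + \<gamma> < 1 + 2 * pend_wt r + 2 * tri_wt r" if "?n \<ge> 2"
        proof -
          have "r > 6" using that nt r(2) by linarith
          moreover have "2 * \<alpha> + \<gamma> = (3 * r - 5) / ?D"
            unfolding \<alpha>\<gamma>(1,2) times_divide_eq_right add_divide_distrib[symmetric] by simp
          ultimately show ?thesis using matched_wts(6)[OF r53] by simp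
        qed
        have w3: "2 * \<alpha> + 2 * \<gamma> < 1 + 3 * pend_wt r + 2 * tri_wt r" if "?n \<ge> 3"
        proof -
          have "r > 7" using that nt r(2) by linarith
          moreover have "2 * \<alpha> + 2 * \<gamma> = (4 * r - 8) / ?D"
            unfolding \<alpha>\<gamma>(1,2) times_divide_eq_right add_divide_distrib[symmetric] by simp
          ultimately show ?thesis using matched_wts(7)[OF r53] by simp
        qed
        have "iy + iz' = 1 \<or> iy + iz' = 2" "iz = 0 \<or> iz = 1"
          using False by (auto simp: iy_def iz'_def iz_def split: if_splits)
        then consider "iz = 0" "iy + iz' = 1" | "iz = 0" "iy + iz' = 2"
          | "iz = 1" "iy + iz' = 1" | "iz = 1" "iy + iz' = 2" by blast
        then show ?thesis
        proof cases
          case 1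
          then have "?n = 1" by simp
          then show ?thesis using w1 1 by simp
        next
          case 2
          then have "?n = 2" by simp
          moreover from this have "2 * \<alpha> + \<gamma> < 1 + 2 * pend_wt r + 2 * tri_wt r"
            by (intro w2) simp
          \<comment> \<open>The total here is \<alpha> + 2\<gamma>, at most 2\<alpha> + \<gamma>
            since \<gamma> \<le> \<alpha>.\<close>
          ultimately show ?thesis using 2 le by simp
        next
          case 3
          then have "?n = 2" by simp
          moreover from this have "2 * \<alpha> + \<gamma> < 1 + 2 * pend_wt r + 2 * tri_wt r"
            by (intro w2) simp
          ultimately show ?thesis using 3 by simp
        next
          case 4
          then have "?n = 3" by simp
          moreover from this have "2 * \<alpha> + 2 * \<gamma> < 1 + 3 * pend_wt r + 2 * tri_wt r"
            by (intro w3) simp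
          ultimately show ?thesis using 4 by simp
        qed
      qed
      finally show "sum f (nbrs E u \<inter> B) < 1 + real ?n * pend_wt r + 2 * tri_wt r" .
    qed
  qed
qed

end

section \<open>The extremal graphs\<close>

lemma (in sgraph) matching_of_card_eq:
  assumes "matching_number E = card E" shows "is_matching E E"
proof -
  obtain M where M: "is_matching E M" "card M = matching_number E" by (rule maximum_matching)
  then have "M = E" using assms by (intro card_subset_eq) (auto simp: is_matching_def)
  then show ?thesis using M by simp
qed

text \<open>Any edge can serve as S_{1,0,0}, with one of its ends as the centre; the other edges are
  isolated.\<close>

lemma (in sgraph) graph_iso_S_ext_of_matching:
  assumes M: "is_matching E E" and ne: "E \<noteq> {}"
  shows "\<exists>k l. graph_iso V E (S_ext_V 1 0 0 k l) (S_ext_E 1 0 0 k l)"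
proof -
  obtain e where "e \<in> E" using ne by blast
  then obtain u w where uw: "{u, w} \<in> E" using edgeE[of e] by metis
  have uniq: "p = q" if "{s, p} \<in> E" "{s, q} \<in> E" for s p q
  proof -
    have D: "e = f" if "e \<in> E" "f \<in> E" "e \<inter> f \<noteq> {}" for e f
      using M that by (auto simp: is_matching_def)
    have "{s, p} = {s, q}" by (rule D[OF that]) simp
    then show ?thesis by (auto simp: doubleton_eq_iff)
  qed
  interpret H: hub V E u "{}"
    using uniq edge_in_V[OF uw] by unfold_locales auto
  have "nbrs E u = {w}" using uw uniq unfolding nbrs_def by blast
  then have count: "card H.pends + card H.mids + 2 * card H.tri_edges = 1" using H.card_nbrs_hub by simp
  have "H.mids = {}"
  proof -
    have "x = u" if "{u, s} \<in> E" "{s, x} \<in> E" for s x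
      using uniq[of s x u] that by (simp add: insert_commute)
    then show ?thesis unfolding H.mids_def by auto
  qed
  then have "card H.mids = 0" by simp
  moreover have "p = 1 \<and> c = 0" if "p + q + 2 * c = 1" "q = 0" for p q c :: nat
    using that by presburger
  from this[OF count \<open>card H.mids = 0\<close>] have "card H.pends = 1" "card H.tri_edges = 0" by blast+
  ultimately show ?thesis using H.graph_iso_S_ext by simp
qed

lemma (in sgraph) eigenvalue_less_or_graph_iso:
  fixes t :: nat and r :: real
  defines "\<beta> \<equiv> matching_number E"
  assumes m: "card E = \<beta> + t" and t: "t \<ge> 1" and \<beta>2: "\<beta> \<ge> 2"
    and abc: "a + b + 2 * c = t + 1"
      "2 * \<beta> - 1 \<le> t \<and> b = 0 \<and> c = \<beta> - 1 \<or> t < 2 * \<beta> - 1 \<and> b = t mod 2 \<and> c = t div 2"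
    and r: "r = real (t + 1) + S_sum a b c r" "r > 3" "r > real t + 2"
  shows "(\<forall>mu. Q_eigenvalue V E mu \<longrightarrow> mu < r)
    \<or> (\<exists>k l. graph_iso V E (S_ext_V a b c k l) (S_ext_E a b c k l))"
proof -
  let ?d = "\<lambda>w. card (nbrs E w)"
  have S_max: "(a', b', c') = (a, b, c) \<or> S_sum a' b' c' r < S_sum a b c r"
    if "a' \<ge> 1" "a' + b' + 2 * c' = t + 1" "b' + c' + 1 \<le> \<beta>" for a' b' c'
    using S_sum_extremal[OF r(2) \<beta>2 that abc] .
  have d1: "?d w \<le> t + 1" for w using degree_matching_bound[of w] m by (simp add: \<beta>_def)
  have d2: "?d p + ?d q \<le> t + 3" if "{p, q} \<in> E" for p q
    using edge_degree_bound(1)[OF that] m by (simp add: \<beta>_def)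
  show ?thesis
  proof (cases "\<exists>p q. {p, q} \<in> E \<and> ?d p + ?d q = t + 3")
    case False
    have "?d p + ?d q \<le> t + 2" if "{p, q} \<in> E" for p q
    proof -
      have "?d p + ?d q \<noteq> t + 3" using False that by blast
      then show ?thesis using d2[OF that] by linarith
    qed
    then have "mu \<le> real (t + 2)" if "Q_eigenvalue V E mu" for mu
      by (rule eigenvalue_edge_degree_bound) (use that in auto)
    then show ?thesis using r(3) by force
  next
    case True
    then obtain p q where pq: "{p, q} \<in> E" "?d p + ?d q = t + 3" by blast
    obtain u v where uv: "{u, v} \<in> E" "?d u + ?d v = t + 3" "?d v \<le> ?d u"
    proof (cases "?d q \<le> ?d p")
      case True then show thesis using that pq by blast
    next
      case False
      then show thesis using that[of q p] pq by (simp add: insert_commute)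
    qed
    have eq: "?d u + ?d v + matching_number E = card E + 3" using uv(2) m by (simp add: \<beta>_def)
    note T = edge_degree_bound(2)[OF uv(1) eq]
    obtain x y where xy: "{u, x} \<in> E" "{v, y} \<in> E" "x \<noteq> v" "y \<noteq> u" "x \<noteq> y"
         "nbrs E x \<subseteq> {u, v}" "nbrs E y \<subseteq> {u, v}"
      using conjunct2[OF T] by blast
    interpret T: tight V E u v x y
    proof
      show "e = f" if "e \<in> E" "f \<in> E" "e \<inter> {u, v} = {}" "f \<inter> {u, v} = {}" "e \<inter> f \<noteq> {}" for e f
        using conjunct1[OF T] that by blast
    qed (fact uv(1) xy)+
    \<comment> \<open>No degree exceeds t + 1, so a degree sum of t + 3 leaves at least 2 for
      v.\<close>
    have dv: "?d v \<ge> 2" using uv d1[of u] by linarith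
    then consider "?d v = 2" | "?d v = 3" | "?d v \<ge> 4" by linarith
    then show ?thesis
    proof cases
      case 1
      interpret H: hub V E u "{}" by (rule T.hub_2[OF 1])
      have du: "?d u = t + 1" using 1 uv by simp
      have cnt: "card H.pends + card H.mids + 2 * card H.tri_edges = t + 1"
        using H.card_nbrs_hub du by simp
      have "card H.pends \<ge> 1" using T.hub_2_counts(1)[OF 1] by (simp add: Suc_le_eq card_gt_0_iff)
      moreover have "card H.mids + card H.tri_edges + 1 \<le> \<beta>"
        using H.card_mids_tri_edges T.hub_2_counts(2)[OF 1] du m by simp
      ultimately consider
          "card H.pends = a" "card H.mids = b" "card H.tri_edges = c"
        | "S_sum (card H.pends) (card H.mids) (card H.tri_edges) r < S_sum a b c r"
        using S_max[OF _ cnt] by auto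
      then show ?thesis
      proof cases
        case 1
        then show ?thesis using H.graph_iso_S_ext by simp
      next
        case 2
        \<comment> \<open>B is empty, so its conditions are vacuous and the deficit at the centre is
          exactly the strict inequality between the two values of \<open>S_sum\<close>.\<close>
        have "mu < r" if "Q_eigenvalue V E mu" for mu
          using 2 du r(1) that by (intro H.eigenvalue_less_hub[of r "\<lambda>_. 1" mu] r(2)) auto
        then show ?thesis by blast
      qed
    next
      case 2
      have "mu < r" if "Q_eigenvalue V E mu" for mu
      proof (rule T.eigenvalue_less_3[OF _ r(1) _ _ _ 2 m \<beta>2 that])
        show "S_sum a' b' c' r \<le> S_sum a b c r"
          if "a' \<ge> 1" "a' + b' + 2 * c' = t + 1" "b' + c' + 1 \<le> \<beta>" for a' b' c'
          using S_max[OF that] by auto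
      qed (use r(3) uv 2 in auto)
      then show ?thesis by blast
    next
      case 3
      have "mu \<le> real (t + 2)" if "Q_eigenvalue V E mu" for mu
        using T.eigenvalue_le_of_degrees_ge_4[OF _ 3 that] 3 uv by simp
      then show ?thesis using r(3) by force
    qed
  qed
qed

theorem theorem1p1:
  fixes V :: "'a set" and E :: "'a set set" and \<beta> m :: nat
  assumes "simple_graph V E"
    and "matching_number E = \<beta>" and "\<beta> \<ge> 2"
    and "card E = m" and "m \<ge> \<beta>"
  defines "a \<equiv> (if 3 * \<beta> - 1 \<le> m then m + 3 - 3 * \<beta> else 1)"
    and "b \<equiv> (if 3 * \<beta> - 1 \<le> m then 0 else if odd (m - \<beta>) then 1 else 0)"
    and "c \<equiv> (if 3 * \<beta> - 1 \<le> m then \<beta> - 1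
              else if odd (m - \<beta>) then (m - \<beta> - 1) div 2 else (m - \<beta>) div 2)"
  shows "q_radius V E \<le> q_radius (S_V a b c) (S_E a b c) \<and>
         (q_radius V E = q_radius (S_V a b c) (S_E a b c) \<longleftrightarrow>
            (\<exists>k l. graph_iso V E (S_ext_V a b c k l) (S_ext_E a b c k l)))"
proof -
  interpret sgraph V E by unfold_locales fact
  obtain t where m: "m = \<beta> + t" using \<open>m \<ge> \<beta>\<close> le_Suc_ex by blast
  \<comment> \<open>In terms of t the condition \<open>3 * \<beta> - 1 \<le> m\<close> reads
    \<open>2 * \<beta> - 1 \<le> t\<close>; otherwise a = 1, and b and c are remainder and quotient
    of t by 2.\<close>
  have abc: "a + b + 2 * c = t + 1"
    "2 * \<beta> - 1 \<le> t \<and> b = 0 \<and> c = \<beta> - 1 \<or> t < 2 * \<beta> - 1 \<and> b = t mod 2 \<and> c = t div 2"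
    using \<open>\<beta> \<ge> 2\<close> by (auto simp: a_def b_def c_def m elim!: oddE evenE)
  have E_ne: "E \<noteq> {}" using \<open>card E = m\<close> \<open>\<beta> \<ge> 2\<close> m by auto
  then have V_ne: "V \<noteq> {}" using edge_in_V by (metis all_not_in_conv edgeE)
  have "\<exists>r. r = real (t + 1) + S_sum a b c r \<and> r \<ge> 2 \<and> (b > 0 \<or> c > 0 \<longrightarrow> r > 3) \<and>
      ((\<forall>mu. Q_eigenvalue V E mu \<longrightarrow> mu < r)
        \<or> (\<exists>k l. graph_iso V E (S_ext_V a b c k l) (S_ext_E a b c k l)))"
  proof (cases "t = 0")
    case True
    then have abc0: "a = 1" "b = 0" "c = 0" using abc \<open>\<beta> \<ge> 2\<close> by presburger+
    have "is_matching E E"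
      using True m \<open>matching_number E = \<beta>\<close> \<open>card E = m\<close> by (intro matching_of_card_eq) simp
    then have "\<exists>k l. graph_iso V E (S_ext_V 1 0 0 k l) (S_ext_E 1 0 0 k l)"
      using E_ne by (rule graph_iso_S_ext_of_matching)
    \<comment> \<open>2 is the largest eigenvalue of a single edge, the graph S_{1,0,0}.\<close>
    then show ?thesis
      by (intro exI[of _ 2]) (simp add: abc0 True S_sum_def pend_wt_def)
  next
    case False
    have bc: "b > 0 \<or> c > 0" using False abc(2) \<open>\<beta> \<ge> 2\<close> by (cases "t = 1") auto
    have "a = 1 \<and> b = 1 \<and> c = 0" if "t = 1" using that abc \<open>\<beta> \<ge> 2\<close> by auto
    then obtain r where r: "r = real (t + 1) + S_sum a b c r" "r > 3" "r > real t + 2"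
      using ex_root[OF abc(1) _ bc] False by auto
    have "(\<forall>mu. Q_eigenvalue V E mu \<longrightarrow> mu < r)
        \<or> (\<exists>k l. graph_iso V E (S_ext_V a b c k l) (S_ext_E a b c k l))"
      using False abc r \<open>matching_number E = \<beta>\<close> \<open>card E = m\<close> \<open>\<beta> \<ge> 2\<close> m
      by (intro eigenvalue_less_or_graph_iso[where t = t]) auto
    then show ?thesis using r by (intro exI[of _ r]) simp
  qed
  then obtain r where r: "r = real (t + 1) + S_sum a b c r" "r \<ge> 2" "b > 0 \<or> c > 0 \<Longrightarrow> r > 3"
    and dich: "(\<forall>mu. Q_eigenvalue V E mu \<longrightarrow> mu < r)
        \<or> (\<exists>k l. graph_iso V E (S_ext_V a b c k l) (S_ext_E a b c k l))" by auto
  \<comment> \<open>Isolated edges contribute no eigenvalue above 2, so the value is the same for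
    all k and l; k = l = 0 is the extremal graph itself.\<close>
  have qS: "q_radius (S_ext_V a b c k l) (S_ext_E a b c k l) = r" for k l
    using r by (intro S_ext_q_radius) (simp_all only: abc(1))
  have "q_radius V E = r"
    if "graph_iso V E (S_ext_V a b c k l) (S_ext_E a b c k l)" for k l
    using q_radius_graph_iso[OF simple simple_graph_S_ext that] qS by simp
  then show ?thesis using dich q_radius_less_iff[OF V_ne, of r] unfolding qS by force
qed

end
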